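(* There exist constants $C^*,c^*>0$ such that the following holds. For $\varepsilon>0$, let $K=K(\varepsilon)=C^*\exp\big(c^*\sqrt{\log(1/\varepsilon)}\big)$. Then for all $n\in\mathbb{N}_1=\{1,2,\dots\}$, if $T_n\sim\mathrm{UA}(n)$, it holds that $\mathbb{P}(\text{\o}\notin\mathcal{A}_K(T_n))\le\varepsilon$.
   Context: Uniform attachment model: $T_1$ consists of a single node, the root \o; for each $n\ge1$, $T_{n+1}$ is obtained from $T_n$ by attaching one new node to a node of $T_n$ chosen uniformly at random, independently of previous choices. We write $T_n\sim\mathrm{UA}(n)$. Centrality: for a finite tree $T=(V,E)$ and $u\in V$, let $(T,u)$ denote $T$ rooted at $u$ and $(T,u)_{v\downarrow}$ the subtree of $(T,u)$ consisting of $v$ and its descendants; set $\varphi_T(u)=\prod_{v\in V\setminus\{u\}}|(T,u)_{v\downarrow}|$. The algorithm $\mathcal{A}_k$ ($k$ a positive integer): given an unlabeled finite tree $T$ with $n$ nodes, order its nodes $v_1,\dots,v_n$ so that $\varphi_T(v_1)\le\dots\le\varphi_T(v_n)$ (ties broken arbitrarily) and output $\{v_1,\dots,v_{k\wedge n}\}$. For non-integer $K$, $\mathcal{A}_K$ is understood as $\mathcal{A}_{\lceil K\rceil}$. *)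

theory Defs
  imports "HOL-Probability.Probability" "Graph_Theory.Graph_Theory"
begin

text \<open>
  A finite simple graph is a \<^locale>\<open>pair_graph\<close>: a finite, symmetric, loop-free set of
  arcs, where an edge between two nodes is represented by its two opposite arcs. Traversing an
  edge back and forth is a \<^const>\<open>pre_digraph.cycle\<close> of length 2, so cycles of the undirected
  graph are those of length at least 3. For the same reason the library's
  predicate \<^const>\<open>Digraph_Component.tree\<close>, which forbids all directed cycles, is not usable here.
  Nonemptiness is part of \<^const>\<open>Digraph_Component.connected\<close>.
\<close>

definition finite_tree :: "'a pair_pre_digraph \<Rightarrow> bool" where
  "finite_tree T \<longleftrightarrow>
     pair_graph T \<and> Digraph_Component.connected (with_proj T) \<and>
     \<not> (\<exists>p. pre_digraph.cycle (with_proj T) p \<and> length p \<ge> 3)"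

text \<open>
  Nodes of the subtree of the tree \<open>T\<close>, rooted at \<open>u\<close>, hanging from \<open>v\<close>: those \<open>w\<close> for which
  \<open>v\<close> lies on the path from \<open>u\<close> to \<open>w\<close> (thus including \<open>v\<close> itself).
\<close>

definition subtree_below :: "'a pair_pre_digraph \<Rightarrow> 'a \<Rightarrow> 'a \<Rightarrow> 'a set" where
  "subtree_below T u v =
     {w \<in> pverts T. \<exists>p. vpath p (with_proj T) \<and> hd p = u \<and> last p = w \<and> v \<in> set p}"

definition centrality :: "'a pair_pre_digraph \<Rightarrow> 'a \<Rightarrow> nat" where
  "centrality T u = (\<Prod>v \<in> pverts T - {u}. card (subtree_below T u v))"

definition central_output :: "nat \<Rightarrow> 'a pair_pre_digraph \<Rightarrow> 'a set \<Rightarrow> bool" where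
  "central_output k T S \<longleftrightarrow>
     (\<exists>vs. distinct vs \<and> set vs = pverts T \<and>
           sorted_wrt (\<lambda>u v. centrality T u \<le> centrality T v) vs \<and>
           S = set (take k vs))"

text \<open>
  \<open>A\<close> is an instance of the algorithm with parameter \<open>k\<close>, for some way of breaking ties. The ties
  may be broken arbitrarily, in particular by looking at the names of the nodes.
\<close>

definition root_finding_algorithm :: "nat \<Rightarrow> ('a pair_pre_digraph \<Rightarrow> 'a set) \<Rightarrow> bool" where
  "root_finding_algorithm k A \<longleftrightarrow> (\<forall>T. finite_tree T \<longrightarrow> central_output k T (A T))"

definition attach_node :: "'a \<Rightarrow> 'a \<Rightarrow> 'a pair_pre_digraph \<Rightarrow> 'a pair_pre_digraph" where
  "attach_node w v T =
     \<lparr> pverts = insert w (pverts T), parcs = {(v, w), (w, v)} \<union> parcs T \<rparr>"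

text \<open>
  The law of the uniform attachment tree with \<open>n\<close> nodes, the nodes being named \<open>1, \<dots>, n\<close> in order
  of arrival. The value at \<open>0\<close> (the empty graph) is a dummy.
\<close>

fun uniform_attachment :: "nat \<Rightarrow> nat pair_pre_digraph pmf" where
  "uniform_attachment 0 = return_pmf \<lparr> pverts = {}, parcs = {} \<rparr>"
| "uniform_attachment (Suc 0) = return_pmf \<lparr> pverts = {1}, parcs = {} \<rparr>"
| "uniform_attachment (Suc (Suc n)) =
     do {
       T \<leftarrow> uniform_attachment (Suc n);
       v \<leftarrow> pmf_of_set (pverts T);
       return_pmf (attach_node (Suc (Suc n)) v T)
     }"

definition ua_root :: nat where
  "ua_root = 1"

end

theory Submission
  imports Defs
begin

text \<open>
  Along the edge from a node to its child \<open>x\<close>, the centrality is multiplied by \<open>(n - s) / s\<close>, where \<open>s\<close> is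
  the size of the subtree hanging from \<open>x\<close>. So the nodes that are at least as central as the root are
  those with \<open>\<Prod> s / (n - s) \<ge> 1\<close> over their path from the root. Bound the factors with \<open>s > n / 2\<close> by their
  product \<open>M\<close> over the whole path to the centroid and the others by \<open>2 s / n\<close>, and take \<open>p\<close>-th roots: the
  number of these nodes is at most \<open>M\<^bsup>1/p\<^esup> F\<close> with \<open>F = \<Sum>\<^sub>v \<Prod> (2 s / n)\<^bsup>1/p\<^esup>\<close>.

  The subtree of the second node has uniform size, and it and the rest of the tree are independent uniform
  attachment trees. This makes the mean of any sum of path products an explicit product, whence \<open>E \<surd>M = O(1)\<close>.
  It also gives a recursion for the moments of \<open>F\<close>, from which \<open>E F\<^sup>k \<le> exp (c k (p + k))\<close> follows by induction
  for all \<open>k \<le> p\<close>. Since Minkowski's inequality would be too lossy there, the bound is quadratic in \<open>k\<close>: this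
  damps the mixed terms of the binomial expansion. Now choose \<open>p\<close> about \<open>\<surd>(ln (1/\<epsilon>))\<close>.
\<close>

section \<open>The moment recursion\<close>

lemma exp_minus_le_quadratic:
  fixes x :: real
  assumes "0 \<le> x"
  shows "exp (- x) \<le> 1 - x + x\<^sup>2 / 2"
proof -
  have "1 + x + x\<^sup>2 / 2 \<le> exp x"
    using exp_lower_Taylor_quadratic[OF assms] by simp
  moreover have "0 \<le> 1 - x + x\<^sup>2 / 2"
    using zero_le_power2[of "x - 1"] by (simp add: power2_eq_square algebra_simps)
  \<comment> \<open>The Taylor polynomials at \<open>x\<close> and \<open>- x\<close> are reciprocal
    up to a fourth-order term, which has the favourable sign.\<close>
  moreover have "(1 - x + x\<^sup>2 / 2) * (1 + x + x\<^sup>2 / 2) = 1 + x ^ 4 / 4"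
    by (simp add: power2_eq_square power4_eq_xxxx algebra_simps)
  hence "1 \<le> (1 - x + x\<^sup>2 / 2) * (1 + x + x\<^sup>2 / 2)"
    by simp
  ultimately have "1 \<le> (1 - x + x\<^sup>2 / 2) * exp x"
    by (meson mult_left_mono order_trans)
  thus ?thesis
    by (simp add: exp_minus field_simps)
qed

text \<open>The estimate for small \<open>\<gamma>\<close>. The grid points have mean 1/2 and mean
  square at most 1/3, so the quadratic Taylor bound saves \<open>\<delta> * (1/2 - 1/6)\<close>.
  Truncating \<open>\<gamma>\<close> to \<open>\<delta> \<le> 1\<close> allows
  \<open>\<delta>\<^sup>2\<close> to be replaced by \<open>\<delta>\<close>.\<close>

lemma exp_grid_sum_le_linear:
  fixes \<gamma> :: real
  assumes "0 \<le> \<gamma>"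
  shows "(\<Sum>i\<le>m. exp (- \<gamma> * (real (i + 1) / real (m + 2)))) \<le> real (m + 1) * (1 - min \<gamma> 1 / 3)"
proof -
  define \<delta> where "\<delta> = min \<gamma> 1"
  have \<delta>: "0 \<le> \<delta>" "\<delta> \<le> 1" "\<delta> \<le> \<gamma>"
    using assms by (auto simp: \<delta>_def)
  define u where "u i = real (i + 1) / real (m + 2)" for i
  have s1: "(\<Sum>i\<le>k. real (i + 1)) = real (k + 1) * real (k + 2) / 2" for k
    by (induction k) (auto simp: field_simps)
  have s2: "(\<Sum>i\<le>k. (real (i + 1))\<^sup>2) = real (k + 1) * real (k + 2) * (2 * real k + 3) / 6" for k
    by (induction k) (auto simp: field_simps power2_eq_square)
  have u1: "(\<Sum>i\<le>m. u i) = real (m + 1) / 2"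
    unfolding u_def sum_divide_distrib[symmetric] s1 by (simp add: field_simps)
  have "(\<Sum>i\<le>m. (u i)\<^sup>2) = real (m + 1) * (2 * real m + 3) / (6 * real (m + 2))"
    unfolding u_def power_divide sum_divide_distrib[symmetric] s2
    by (simp add: divide_simps power2_eq_square)
  also have "\<dots> \<le> real (m + 1) / 3"
    by (simp add: divide_simps)
  finally have u2: "(\<Sum>i\<le>m. (u i)\<^sup>2) \<le> real (m + 1) / 3" .
  have "(\<Sum>i\<le>m. exp (- \<gamma> * u i)) \<le> (\<Sum>i\<le>m. 1 - \<delta> * u i + \<delta> * (u i)\<^sup>2 / 2)"
  proof (rule sum_mono)
    fix i
    have u: "0 \<le> u i" by (simp add: u_def)
    have "exp (- \<gamma> * u i) \<le> exp (- (\<delta> * u i))"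
      using u \<delta> by (simp add: mult_right_mono)
    also have "\<dots> \<le> 1 - \<delta> * u i + (\<delta> * u i)\<^sup>2 / 2"
      using u \<delta> by (intro exp_minus_le_quadratic) simp
    also have "(\<delta> * u i)\<^sup>2 \<le> \<delta> * (u i)\<^sup>2"
      using \<delta> mult_left_le[of \<delta> \<delta>]
      by (simp add: power_mult_distrib power2_eq_square[of \<delta>] mult_right_mono)
    finally show "exp (- \<gamma> * u i) \<le> 1 - \<delta> * u i + \<delta> * (u i)\<^sup>2 / 2" by simp
  qed
  also have "\<dots> = real (m + 1) - \<delta> * (\<Sum>i\<le>m. u i) + \<delta> / 2 * (\<Sum>i\<le>m. (u i)\<^sup>2)"
    by (simp add: sum.distrib sum_subtractf sum_distrib_left)
  also have "\<dots> \<le> real (m + 1) - \<delta> * (real (m + 1) / 2) + \<delta> / 2 * (real (m + 1) / 3)"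
    unfolding u1 using u2 \<delta> by (intro add_left_mono mult_left_mono) auto
  also have "\<dots> = real (m + 1) * (1 - \<delta> / 3)"
    by (simp add: algebra_simps)
  finally show ?thesis by (simp add: u_def \<delta>_def)
qed

text \<open>The estimate for large \<open>\<gamma>\<close>: a geometric series, compared with its
  infinite sum. The factor 2 absorbs \<open>m + 2 \<le> 2 * (m + 1)\<close>.\<close>

lemma exp_grid_sum_le_inverse:
  fixes \<gamma> :: real
  assumes "0 < \<gamma>"
  shows "(\<Sum>i\<le>m. exp (- \<gamma> * (real (i + 1) / real (m + 2)))) \<le> real (m + 1) * (2 / \<gamma>)"
proof -
  define q where "q = exp (- (\<gamma> / real (m + 2)))"
  have q: "0 < q" "q < 1" using assms by (auto simp: q_def)
  have eq: "exp (- \<gamma> * (real (i + 1) / real (m + 2))) = q * q ^ i" for i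
  proof -
    have "- \<gamma> * (real (i + 1) / real (m + 2)) = - (\<gamma> / real (m + 2)) + real i * - (\<gamma> / real (m + 2))"
      by (simp add: add_divide_distrib distrib_left)
    thus ?thesis unfolding q_def by (simp only: exp_add exp_of_nat_mult)
  qed
  have "(\<Sum>i\<le>m. exp (- \<gamma> * (real (i + 1) / real (m + 2)))) = q * (\<Sum>i<Suc m. q ^ i)"
    unfolding eq by (simp add: sum_distrib_left lessThan_Suc_atMost)
  also have "\<dots> = q * ((1 - q ^ Suc m) / (1 - q))"
    using q by (subst sum_gp_strict) auto
  also have "\<dots> \<le> q * (1 / (1 - q))"
    using q by (intro mult_left_mono divide_right_mono) auto
  also have "\<dots> \<le> real (m + 2) / \<gamma>"
  proof -
    have "1 + \<gamma> / real (m + 2) \<le> 1 / q"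
      using exp_ge_add_one_self[of "\<gamma> / real (m + 2)"] by (simp add: q_def exp_minus inverse_eq_divide)
    hence "(1 + \<gamma> / real (m + 2)) * q \<le> 1"
      using q by (simp add: field_simps)
    thus ?thesis using q assms by (simp add: field_simps)
  qed
  also have "\<dots> \<le> real (m + 1) * (2 / \<gamma>)"
    using assms by (simp add: field_simps)
  finally show ?thesis .
qed

text \<open>Bernoulli's inequality. The factor \<open>p\<close> lost here is regained from the
  exponent \<open>k * (p + k)\<close> of the moment bound.\<close>

lemma root_one_minus_le:
  fixes x :: real
  assumes "0 < p" "x \<le> 1"
  shows "root p (1 - x) \<le> 1 - x / real p"
proof -
  have xp: "x / real p \<le> 1" using assms by (simp add: field_simps)
  have "1 - x \<le> (1 - x / real p) ^ p"
    using Bernoulli_inequality[of "- (x / real p)" p] xp assms by simp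
  hence "root p (1 - x) \<le> root p ((1 - x / real p) ^ p)"
    using assms by simp
  also have "\<dots> = 1 - x / real p"
    using assms xp by (intro real_root_power_cancel) auto
  finally show ?thesis .
qed

lemma binomial_le_power:
  "real (k choose j) \<le> real k ^ j"
proof (cases "j \<le> k")
  case True
  thus ?thesis using binomial_le_pow[of j k] by (metis of_nat_le_iff of_nat_power)
next
  case False
  thus ?thesis by (simp add: binomial_eq_0)
qed

text \<open>The middle terms of the binomial expansion: the factor \<open>exp (- 2 c w j (k - j))\<close> is
  what remains of the quadratic part of the exponent \<open>k (p + k)\<close> in the moment bound.\<close>

lemma middle_term_le:
  fixes w c :: real
  assumes w: "0 \<le> w" "w ^ k \<le> 2" and c: "0 \<le> c" and j: "j \<le> k"
  defines "q \<equiv> real k * w * exp (- (c * (real k * w)))"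
  shows "real (k choose j) * w ^ j * exp (- (2 * c * w * real j * real (k - j)))
           \<le> 2 * (q ^ j + q ^ (k - j))"
proof -
  have q: "0 \<le> q" unfolding q_def using w by simp
  \<comment> \<open>Here \<open>i\<close> is the smaller of \<open>j\<close> and
    \<open>k - j\<close>. Since \<open>k - i\<close> is at least \<open>k / 2\<close>, the damping
    factor is at most the \<open>i\<close>-th power of
    \<open>exp (- (c * (real k * w)))\<close>.\<close>
  have key: "real (k choose i) * w ^ i * exp (- (2 * c * w * real j * real (k - j))) \<le> q ^ i"
    if "2 * i \<le> k" "j * (k - j) = i * (k - i)" for i
  proof -
    have "real k \<le> 2 * real (k - i)" using that by linarith
    hence "c * w * real i * real k \<le> c * w * real i * (2 * real (k - i))"
      using w c by (intro mult_left_mono) auto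
    also have "\<dots> = 2 * c * w * (real i * real (k - i))" by simp
    also have "real i * real (k - i) = real j * real (k - j)"
      using that(2) by (metis of_nat_mult)
    finally have "c * w * real i * real k \<le> 2 * c * w * real j * real (k - j)"
      by (simp add: mult.assoc)
    hence "exp (- (2 * c * w * real j * real (k - j))) \<le> exp (- (c * (real k * w))) ^ i"
      unfolding exp_of_nat_mult[symmetric] by (simp add: mult_ac)
    hence "real (k choose i) * w ^ i * exp (- (2 * c * w * real j * real (k - j)))
             \<le> real k ^ i * w ^ i * exp (- (c * (real k * w))) ^ i"
      using w binomial_le_power[of k i] by (intro mult_mono) auto
    also have "\<dots> = q ^ i" by (simp add: q_def power_mult_distrib)
    finally show ?thesis .
  qed
  show ?thesis
  proof (cases "2 * j \<le> k")
    case True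
    have "real (k choose j) * w ^ j * exp (- (2 * c * w * real j * real (k - j))) \<le> q ^ j"
      using key[of j] True by simp
    also have "q ^ j \<le> 2 * (q ^ j + q ^ (k - j))"
      using zero_le_power[OF q, of j] zero_le_power[OF q, of "k - j"] by simp
    finally show ?thesis .
  next
    case False
    define i where "i = k - j"
    have i: "2 * i \<le> k" "i \<le> j" "k - i = j" "i \<le> k" using False j by (auto simp: i_def)
    \<comment> \<open>Exchanging \<open>w ^ j\<close> for \<open>w ^ i\<close> costs a factor of at
      most 2: either \<open>w \<le> 1\<close>, or the power is controlled by
      \<open>w ^ k \<le> 2\<close>.\<close>
    have "w ^ (j - i) \<le> 2"
    proof (cases "w \<le> 1")
      case True
      thus ?thesis using w power_le_one[of w "j - i"] by linarith
    next
      case False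
      hence "w ^ (j - i) \<le> w ^ k" using j by (intro power_increasing) auto
      thus ?thesis using w by linarith
    qed
    have "w ^ j = w ^ (j - i) * w ^ i" using i by (simp flip: power_add)
    also have "\<dots> \<le> 2 * w ^ i" using \<open>w ^ (j - i) \<le> 2\<close> w by (intro mult_right_mono) auto
    finally have "real (k choose i) * w ^ j * exp (- (2 * c * w * real j * real (k - j)))
        \<le> real (k choose i) * (2 * w ^ i) * exp (- (2 * c * w * real j * real (k - j)))"
      using w by (intro mult_mono mult_left_mono) auto
    also have "\<dots> \<le> 2 * q ^ i"
      using key[of i] i by (simp add: i_def[symmetric] mult_ac)
    finally show ?thesis
      using zero_le_power[OF q, of j] binomial_symmetric[OF j] by (simp add: i_def)
  qed
qed

text \<open>The induction step for the moments of \<open>F\<close>. The subtree of the second node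
  has \<open>i + 1\<close> of the \<open>m + 2\<close> nodes, and \<open>x\<close>, \<open>y\<close>
  are the \<open>p\<close>-th roots of the shares of this subtree and of the rest. After division by
  the exponential on the right, which gives \<open>T\<close>, the terms \<open>j = 0\<close> and
  \<open>j = k\<close> are small by Bernoulli's inequality and the others by the quadratic
  damping.\<close>

lemma moment_recursion_sum_le:
  fixes w :: real and m :: nat
  assumes k: "1 \<le> k" "k \<le> p" and w: "0 \<le> w" "w ^ k \<le> 2"
  defines "x \<equiv> (\<lambda>i. root p (real (i + 1) / real (m + 2)))"
    and "y \<equiv> (\<lambda>i. root p (real (m - i + 1) / real (m + 2)))"
  shows "(\<Sum>i\<le>m. \<Sum>j\<le>k. real (k choose j) * (w * x i) ^ j *
            exp (72 * (real (k - j) * real (p + (k - j)) * (w * y i) + real j * real (p + j) * (w * x i))))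
         \<le> real (m + 1) * exp (72 * (real k * real (p + k) * w))"
proof -
  define r where "r = real k * w"
  define \<gamma> where "\<gamma> = 72 * r"
  define u where "u i = real (i + 1) / real (m + 2)" for i
  define T where "T i j = real (k choose j) * (w * x i) ^ j *
     exp (72 * (real (k - j) * real (p + (k - j)) * (w * y i) + real j * real (p + j) * (w * x i))
          - 72 * (real k * real (p + k) * w))" for i j
  have p: "0 < p" using k by simp
  have r: "0 \<le> r" using w by (simp add: r_def)
  have x: "0 \<le> x i" "x i \<le> 1" "x i \<le> 1 - (1 - u i) / real p" if "i \<le> m" for i
  proof -
    show "0 \<le> x i" by (simp add: x_def real_root_ge_zero)
    show "x i \<le> 1 - (1 - u i) / real p"
      using root_one_minus_le[of p "1 - u i"] p that by (simp add: x_def u_def)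
    moreover have "0 \<le> (1 - u i) / real p" using that by (simp add: u_def)
    ultimately show "x i \<le> 1" by linarith
  qed
  have y: "0 \<le> y i" "y i \<le> 1" "y i \<le> 1 - u i / real p" if "i \<le> m" for i
  proof -
    have eq: "real (m - i + 1) / real (m + 2) = 1 - u i"
      using that by (simp add: u_def field_simps)
    show "0 \<le> y i" by (simp add: y_def real_root_ge_zero)
    show "y i \<le> 1 - u i / real p"
      using root_one_minus_le[of p "u i"] p that unfolding y_def eq by (simp add: u_def)
    moreover have "0 \<le> u i / real p" using that by (simp add: u_def)
    ultimately show "y i \<le> 1" by linarith
  qed
  have T_nonneg: "0 \<le> T i j" if "i \<le> m" for i j
    using x[OF that] w by (simp add: T_def)
  have T_mid: "T i j \<le> real (k choose j) * w ^ j * exp (- (2 * 72 * w * real j * real (k - j)))"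
    if "i \<le> m" "j \<le> k" for i j
    unfolding T_def
  proof (intro mult_mono)
    show "(w * x i) ^ j \<le> w ^ j"
      using x[OF that(1)] w by (intro power_mono) (auto simp: mult_left_le)
    have "real (k - j) * real (p + (k - j)) * (w * y i) + real j * real (p + j) * (w * x i)
       \<le> real (k - j) * real (p + (k - j)) * w + real j * real (p + j) * w"
      using x[OF that(1)] y[OF that(1)] w
      by (intro add_mono mult_left_mono) (auto simp: mult_left_le)
    \<comment> \<open>The part of the exponent linear in \<open>k\<close> is additive over
      \<open>j\<close> and \<open>k - j\<close>; the quadratic part leaves the cross term.\<close>
    also have "\<dots> = real k * real (p + k) * w - 2 * w * real j * real (k - j)"
      using that(2) by (simp add: algebra_simps)
    finally show "exp (72 * (real (k - j) * real (p + (k - j)) * (w * y i) + real j * real (p + j) * (w * x i))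
          - 72 * (real k * real (p + k) * w)) \<le> exp (- (2 * 72 * w * real j * real (k - j)))"
      by simp
  qed (use w x[OF that(1)] in auto)
  \<comment> \<open>Only the share \<open>k * p\<close> of \<open>k * (p + k)\<close> is kept: its
    \<open>p\<close> cancels the \<open>1 / p\<close> from Bernoulli's inequality.\<close>
  have aux: "real k * real (p + k) * (w * z) - real k * real (p + k) * w \<le> - (r * v)"
    if "z \<le> 1 - v / real p" "0 \<le> v" for z v
  proof -
    have "real k * real (p + k) * (w * z) - real k * real (p + k) * w
        = real k * real (p + k) * w * (z - 1)" by (simp add: algebra_simps)
    also have "\<dots> \<le> real k * real (p + k) * w * (- (v / real p))"
      using that w by (intro mult_left_mono) auto
    also have "\<dots> \<le> real k * real p * w * (- (v / real p))"
      using that w by (intro mult_right_mono_neg mult_right_mono mult_left_mono) auto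
    also have "\<dots> = - (r * v)" using p by (simp add: r_def)
    finally show ?thesis .
  qed
  have T_0: "T i 0 \<le> exp (- \<gamma> * u i)" if "i \<le> m" for i
    using aux[of "y i" "u i"] y[OF that] by (simp add: T_def \<gamma>_def u_def)
  have T_k: "T i k \<le> w ^ k * exp (- \<gamma> * u (m - i))" if "i \<le> m" for i
  proof -
    have "1 - u i = u (m - i)" using that by (simp add: u_def field_simps)
    hence "72 * (real k * real (p + k) * (w * x i)) - 72 * (real k * real (p + k) * w) \<le> - \<gamma> * u (m - i)"
      using aux[of "x i" "1 - u i"] x[OF that] by (simp add: \<gamma>_def u_def)
    moreover have "(w * x i) ^ k \<le> w ^ k"
      using x[OF that] w by (intro power_mono) (auto simp: mult_left_le)
    ultimately show ?thesis
      unfolding T_def using w by (auto intro!: mult_mono)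
  qed
  have rev: "(\<Sum>i\<le>m. exp (- \<gamma> * u (m - i))) = (\<Sum>i\<le>m. exp (- \<gamma> * u i))"
    by (rule sum.reindex_bij_witness[of _ "\<lambda>i. m - i" "\<lambda>i. m - i"]) auto
  have main: "(\<Sum>i\<le>m. \<Sum>j\<le>k. T i j) \<le> real (m + 1)"
  \<comment> \<open>The threshold 12 fits both cases. Below it, the bound \<open>2 * r\<close> for
    the terms with \<open>j \<ge> 1\<close> is at most the average saving
    \<open>min \<gamma> 1 / 3\<close> of the terms \<open>j = 0\<close>. Above it, the extreme terms
    contribute at most \<open>6 / \<gamma> \<le> 1 / 2\<close> on average and the middle ones at
    most \<open>1 / 2\<close>.\<close>
  proof (cases "\<gamma> \<le> 12")
    case True
    have r1: "r \<le> 1" using True by (simp add: \<gamma>_def)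
    have "(\<Sum>j\<le>k. T i j) \<le> exp (- \<gamma> * u i) + 2 * r" if "i \<le> m" for i
    proof -
      have "(\<Sum>j\<le>k. T i j) = T i 0 + (\<Sum>j\<in>{1..k}. T i j)"
        by (simp add: atMost_atLeast0 sum.atLeast_Suc_atMost)
      also have "(\<Sum>j\<in>{1..k}. T i j) \<le> (\<Sum>j\<in>{1..k}. real (k choose j) * w ^ j)"
      proof (rule sum_mono)
        fix j assume j: "j \<in> {1..k}"
        have "T i j \<le> real (k choose j) * w ^ j * exp (- (2 * 72 * w * real j * real (k - j)))"
          using T_mid[OF that] j by simp
        also have "\<dots> \<le> real (k choose j) * w ^ j * 1"
          using w by (intro mult_left_mono) auto
        finally show "T i j \<le> real (k choose j) * w ^ j" by simp
      qed
      also have "(\<Sum>j\<in>{1..k}. real (k choose j) * w ^ j) = (\<Sum>j\<le>k. real (k choose j) * w ^ j) - 1"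
        by (simp add: atMost_atLeast0 sum.atLeast_Suc_atMost)
      also have "(\<Sum>j\<le>k. real (k choose j) * w ^ j) = (1 + w) ^ k"
        by (subst add.commute, subst binomial_ring) simp
      also have "(1 + w) ^ k \<le> exp w ^ k"
        using w by (intro power_mono exp_ge_add_one_self) auto
      also have "exp w ^ k = exp r" by (simp add: r_def exp_of_nat_mult)
      also have "exp r \<le> 1 + 2 * r"
      proof -
        have "exp r \<le> 1 + r + r\<^sup>2" using r r1 by (rule exp_bound)
        also have "r\<^sup>2 \<le> r" using r r1 by (simp add: power2_eq_square mult_left_le)
        finally show ?thesis by simp
      qed
      finally show ?thesis using T_0[OF that] by simp
    qed
    hence "(\<Sum>i\<le>m. \<Sum>j\<le>k. T i j) \<le> (\<Sum>i\<le>m. exp (- \<gamma> * u i) + 2 * r)"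
      by (intro sum_mono) auto
    also have "\<dots> = (\<Sum>i\<le>m. exp (- \<gamma> * u i)) + real (m + 1) * (2 * r)"
      by (simp add: sum.distrib)
    also have "\<dots> \<le> real (m + 1) * (1 - min \<gamma> 1 / 3) + real (m + 1) * (2 * r)"
      using exp_grid_sum_le_linear[of \<gamma> m] r by (simp add: u_def \<gamma>_def)
    also have "\<dots> = real (m + 1) * (1 - min \<gamma> 1 / 3 + 2 * r)"
      by (simp add: algebra_simps)
    also have "\<dots> \<le> real (m + 1) * 1"
      using True r by (intro mult_left_mono) (auto simp: \<gamma>_def min_def)
    finally show ?thesis by simp
  next
    case False
    hence \<gamma>: "12 \<le> \<gamma>" by simp
    define q where "q = r * exp (- \<gamma>)"
    have q0: "0 \<le> q" using r by (simp add: q_def)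
    have q: "q \<le> 1 / 72"
    proof -
      have "\<gamma> \<le> exp \<gamma>" using exp_ge_add_one_self[of \<gamma>] by linarith
      hence "\<gamma> * exp (- \<gamma>) \<le> 1" by (simp add: exp_minus field_simps)
      thus ?thesis by (simp add: q_def \<gamma>_def)
    qed
    have geo: "(\<Sum>j\<in>{1..<k}. q ^ j) \<le> 1 / 71"
    proof -
      have "(\<Sum>j\<in>{1..<k}. q ^ j) = (\<Sum>j<k. q ^ j) - 1"
        using k by (simp add: lessThan_atLeast0 sum.atLeast_Suc_lessThan)
      also have "(\<Sum>j<k. q ^ j) = (1 - q ^ k) / (1 - q)"
        using q by (subst sum_gp_strict) auto
      also have "\<dots> \<le> 1 / (1 - 1 / 72)"
        using q q0 by (intro frac_le) auto
      finally show ?thesis by simp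
    qed
    have geo': "(\<Sum>j\<in>{1..<k}. q ^ (k - j)) = (\<Sum>j\<in>{1..<k}. q ^ j)"
      by (rule sum.reindex_bij_witness[of _ "\<lambda>i. k - i" "\<lambda>i. k - i"]) auto
    have "(\<Sum>j\<le>k. T i j) \<le> exp (- \<gamma> * u i) + 2 * exp (- \<gamma> * u (m - i)) + 1 / 2" if "i \<le> m" for i
    proof -
      have "{..k} = insert 0 (insert k {1..<k})" using k by auto
      hence "(\<Sum>j\<le>k. T i j) = T i 0 + T i k + (\<Sum>j\<in>{1..<k}. T i j)"
        using k by simp
      also have "(\<Sum>j\<in>{1..<k}. T i j) \<le> (\<Sum>j\<in>{1..<k}. 2 * (q ^ j + q ^ (k - j)))"
      proof (rule sum_mono)
        fix j assume j: "j \<in> {1..<k}"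
        show "T i j \<le> 2 * (q ^ j + q ^ (k - j))"
          using T_mid[OF that, of j] middle_term_le[OF w, of 72 j] j
          by (simp add: q_def r_def \<gamma>_def)
      qed
      also have "\<dots> = 2 * ((\<Sum>j\<in>{1..<k}. q ^ j) + (\<Sum>j\<in>{1..<k}. q ^ (k - j)))"
        by (simp add: sum_distrib_left sum.distrib)
      also have "\<dots> \<le> 1 / 2" using geo unfolding geo' by simp
      finally have "(\<Sum>j\<le>k. T i j) \<le> T i 0 + T i k + 1 / 2" by simp
      moreover have "w ^ k * exp (- \<gamma> * u (m - i)) \<le> 2 * exp (- \<gamma> * u (m - i))"
        using w by (intro mult_right_mono) auto
      ultimately show ?thesis using T_0[OF that] T_k[OF that] by linarith
    qed
    hence "(\<Sum>i\<le>m. \<Sum>j\<le>k. T i j) \<le> (\<Sum>i\<le>m. exp (- \<gamma> * u i) + 2 * exp (- \<gamma> * u (m - i)) + 1 / 2)"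
      by (intro sum_mono) auto
    also have "\<dots> = (\<Sum>i\<le>m. exp (- \<gamma> * u i)) + 2 * (\<Sum>i\<le>m. exp (- \<gamma> * u (m - i))) + real (m + 1) / 2"
      by (simp add: sum.distrib sum_distrib_left)
    also have "\<dots> = 3 * (\<Sum>i\<le>m. exp (- \<gamma> * u i)) + real (m + 1) / 2"
      unfolding rev by simp
    also have "\<dots> \<le> 3 * (real (m + 1) * (2 / \<gamma>)) + real (m + 1) / 2"
      using exp_grid_sum_le_inverse[of \<gamma> m] \<gamma> unfolding u_def
      by (intro add_right_mono mult_left_mono) auto
    also have "\<dots> = real (m + 1) * (6 / \<gamma> + 1 / 2)"
      by (simp add: algebra_simps)
    also have "\<dots> \<le> real (m + 1) * 1"
      using \<gamma> by (intro mult_left_mono) (auto simp: field_simps)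
    finally show ?thesis by simp
  qed
  have "(\<Sum>i\<le>m. \<Sum>j\<le>k. real (k choose j) * (w * x i) ^ j *
            exp (72 * (real (k - j) * real (p + (k - j)) * (w * y i) + real j * real (p + j) * (w * x i))))
      = (\<Sum>i\<le>m. \<Sum>j\<le>k. T i j) * exp (72 * (real k * real (p + k) * w))"
    unfolding T_def sum_distrib_right
    by (intro sum.cong refl) (simp add: exp_diff)
  also have "\<dots> \<le> real (m + 1) * exp (72 * (real k * real (p + k) * w))"
    using main by (intro mult_right_mono) auto
  finally show ?thesis .
qed

section \<open>Shapes of uniform attachment trees\<close>

text \<open>\<open>Graft a b\<close> joins the root of \<open>b\<close> by an edge to the root of \<open>a\<close>, which stays the root.\<close>

datatype 'a rtree = Vertex 'a | Graft "'a rtree" "'a rtree"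

fun rt_size :: "'a rtree \<Rightarrow> nat" where
  "rt_size (Vertex x) = 1"
| "rt_size (Graft a b) = rt_size a + rt_size b"

lemma rt_size_pos [simp]: "0 < rt_size t"
  by (induction t) auto

text \<open>\<open>leaf_sum f t\<close> adds up \<open>f\<close> over the trees obtained from the shape \<open>t\<close> by attaching a leaf to one of its nodes.\<close>

fun leaf_sum :: "(unit rtree \<Rightarrow> real) \<Rightarrow> unit rtree \<Rightarrow> real" where
  "leaf_sum f (Vertex x) = f (Graft (Vertex ()) (Vertex ()))"
| "leaf_sum f (Graft a b) = leaf_sum (\<lambda>a'. f (Graft a' b)) a + leaf_sum (\<lambda>b'. f (Graft a b')) b"

text \<open>The mean over the shapes of uniform attachment trees with \<open>n + 1\<close> (not \<open>n\<close>) nodes.\<close>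

fun ua_mean :: "nat \<Rightarrow> (unit rtree \<Rightarrow> real) \<Rightarrow> real" where
  "ua_mean 0 f = f (Vertex ())"
| "ua_mean (Suc n) f = ua_mean n (leaf_sum f) / real (Suc n)"

lemma leaf_sum_add: "leaf_sum (\<lambda>t. f t + g t) = (\<lambda>t. leaf_sum f t + leaf_sum g t)"
proof
  show "leaf_sum (\<lambda>t. f t + g t) t = leaf_sum f t + leaf_sum g t" for t
    by (induction t arbitrary: f g) auto
qed

lemma leaf_sum_cmult: "leaf_sum (\<lambda>t. c * f t) = (\<lambda>t. c * leaf_sum f t)"
proof
  show "leaf_sum (\<lambda>t. c * f t) t = c * leaf_sum f t" for t
    by (induction t arbitrary: f) (auto simp: distrib_left)
qed

lemma leaf_sum_mono:
  assumes "\<And>s. rt_size s = Suc (rt_size t) \<Longrightarrow> f s \<le> g s"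
  shows "leaf_sum f t \<le> leaf_sum g t"
  using assms by (induction t arbitrary: f g) (auto intro!: add_mono)

lemma ua_mean_mono:
  assumes "\<And>t. rt_size t = Suc n \<Longrightarrow> f t \<le> g t"
  shows "ua_mean n f \<le> ua_mean n g"
  using assms
proof (induction n arbitrary: f g)
  case (Suc n)
  have "ua_mean n (leaf_sum f) \<le> ua_mean n (leaf_sum g)"
    using Suc.prems by (intro Suc.IH leaf_sum_mono) auto
  thus ?case by (simp add: divide_right_mono)
qed simp

lemma ua_mean_cong:
  assumes "\<And>t. rt_size t = Suc n \<Longrightarrow> f t = g t"
  shows "ua_mean n f = ua_mean n g"
  using ua_mean_mono[of n f g] ua_mean_mono[of n g f] assms by force

lemma ua_mean_add: "ua_mean n (\<lambda>t. f t + g t) = ua_mean n f + ua_mean n g"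
  by (induction n arbitrary: f g) (auto simp: leaf_sum_add add_divide_distrib)

lemma ua_mean_cmult: "ua_mean n (\<lambda>t. c * f t) = c * ua_mean n f"
  by (induction n arbitrary: f) (auto simp: leaf_sum_cmult)

lemma ua_mean_const: "ua_mean n (\<lambda>t. c) = c"
proof (induction n)
  case (Suc n)
  have "leaf_sum (\<lambda>t. c) t = real (rt_size t) * c" for t
    by (induction t) (auto simp: distrib_right)
  hence "ua_mean n (leaf_sum (\<lambda>t. c)) = ua_mean n (\<lambda>t. real (Suc n) * c)"
    by (intro ua_mean_cong) simp
  thus ?case by (simp add: ua_mean_cmult Suc)
qed simp

lemma ua_mean_sum:
  assumes "finite I"
  shows "ua_mean n (\<lambda>t. \<Sum>i\<in>I. f i t) = (\<Sum>i\<in>I. ua_mean n (f i))"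
  using assms by (induction I) (auto simp: ua_mean_const ua_mean_add)

lemma ua_mean_leaf_sum_commute:
  "ua_mean n (\<lambda>t. leaf_sum (\<lambda>s. f s t) s) = leaf_sum (\<lambda>s. ua_mean n (f s)) s"
  by (induction s arbitrary: f) (auto simp: ua_mean_add)

lemma ua_mean_leaf_sum: "ua_mean n (leaf_sum f) = real (Suc n) * ua_mean (Suc n) f"
  by simp

text \<open>The right argument of the outermost \<^const>\<open>Graft\<close> is the subtree hanging from the second node.
  Its size evolves like a Polya urn and is therefore uniform.\<close>

lemma ua_mean_split:
  "ua_mean (Suc n) f =
     (\<Sum>i\<le>n. ua_mean (n - i) (\<lambda>s. ua_mean i (\<lambda>t. f (Graft s t)))) / real (Suc n)"
proof (induction n arbitrary: f)
  case 0
  show ?case by simp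
next
  case (Suc n)
  define D where "D i j = ua_mean i (\<lambda>s. ua_mean j (\<lambda>t. f (Graft s t)))" for i j
  \<comment> \<open>The new leaf falls into \<open>s\<close> or into \<open>t\<close>, weighted by
    their sizes: one draw from the urn.\<close>
  have "ua_mean (n - i) (\<lambda>s. ua_mean i (\<lambda>t. leaf_sum f (Graft s t)))
     = real (Suc n - i) * D (Suc n - i) i + real (Suc i) * D (n - i) (Suc i)" if "i \<le> n" for i
  proof -
    have "ua_mean (n - i) (\<lambda>s. ua_mean i (\<lambda>t. leaf_sum f (Graft s t)))
       = ua_mean (n - i) (leaf_sum (\<lambda>s. ua_mean i (\<lambda>t. f (Graft s t))))
         + ua_mean (n - i) (\<lambda>s. ua_mean i (leaf_sum (\<lambda>t. f (Graft s t))))"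
      by (simp add: ua_mean_add ua_mean_leaf_sum_commute)
    also have "\<dots> = real (Suc (n - i)) * D (Suc (n - i)) i + real (Suc i) * D (n - i) (Suc i)"
      unfolding ua_mean_leaf_sum D_def ua_mean_cmult ..
    finally show ?thesis using that by (simp add: Suc_diff_le)
  qed
  hence "real (Suc n) * ua_mean (Suc n) (leaf_sum f)
      = (\<Sum>i\<le>n. real (Suc n - i) * D (Suc n - i) i) + (\<Sum>i\<le>n. real (Suc i) * D (n - i) (Suc i))"
    unfolding Suc by (simp add: sum.distrib)
  \<comment> \<open>Both ranges extend to \<open>i \<le> Suc n\<close> since the added terms have
    weight 0; for every \<open>i\<close> the two weights then add up to
    \<open>Suc n\<close>.\<close>
  also have "(\<Sum>i\<le>n. real (Suc n - i) * D (Suc n - i) i) = (\<Sum>i\<le>Suc n. real (Suc n - i) * D (Suc n - i) i)"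
    by simp
  also have "(\<Sum>i\<le>n. real (Suc i) * D (n - i) (Suc i)) = (\<Sum>i\<le>Suc n. real i * D (Suc n - i) i)"
    unfolding sum.atMost_Suc_shift[of _ n] by simp
  also have "(\<Sum>i\<le>Suc n. real (Suc n - i) * D (Suc n - i) i) + (\<Sum>i\<le>Suc n. real i * D (Suc n - i) i)
     = real (Suc n) * (\<Sum>i\<le>Suc n. D (Suc n - i) i)"
    unfolding sum.distrib[symmetric] sum_distrib_left
    by (intro sum.cong refl) (simp add: algebra_simps)
  finally have "ua_mean (Suc n) (leaf_sum f) = (\<Sum>i\<le>Suc n. D (Suc n - i) i)"
    by (subst (asm) mult_cancel_left) simp
  thus ?case by (subst ua_mean.simps) (simp only: D_def)
qed

text \<open>\<open>path_sum g t\<close> is the sum over the nodes \<open>v\<close> of the products of \<open>g |t\<^sub>x|\<close> over the nodes \<open>x\<close>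
  other than the root on the path from the root to \<open>v\<close>, where \<open>t\<^sub>x\<close> is the subtree hanging from \<open>x\<close>.\<close>

fun path_sum :: "(nat \<Rightarrow> real) \<Rightarrow> 'a rtree \<Rightarrow> real" where
  "path_sum g (Vertex x) = 1"
| "path_sum g (Graft a b) = path_sum g a + g (rt_size b) * path_sum g b"

lemma path_sum_nonneg:
  assumes "\<And>n. 0 \<le> g n"
  shows "0 \<le> path_sum g t"
  using assms by (induction t) auto

text \<open>Splitting at the second node expresses each mean as an average of earlier ones. The
  product solves this recursion, because the average collapses by \<open>P_sum\<close>.\<close>

lemma ua_mean_path_sum:
  "ua_mean n (path_sum g) = (\<Prod>a\<in>{1..n}. 1 + g a / real a)"
proof (induction n rule: less_induct)
  case (less n)
  define P where "P n = (\<Prod>a\<in>{1..n}. 1 + g a / real a)" for n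
  show ?case
  proof (cases n)
    case (Suc m)
    have P_sum: "(\<Sum>i\<le>k. P i + g (Suc i) * P i) = real (Suc k) * P (Suc k)" for k
    proof (induction k)
      case (Suc k)
      have "P (Suc (Suc k)) = P (Suc k) * (1 + g (Suc (Suc k)) / real (Suc (Suc k)))"
        by (simp add: P_def)
      thus ?case using Suc by (simp add: field_simps)
    qed (simp add: P_def)
    have "ua_mean (m - i) (\<lambda>s. ua_mean i (\<lambda>t. path_sum g (Graft s t))) = P (m - i) + g (Suc i) * P i"
      if "i \<le> m" for i
    proof -
      have "ua_mean i (\<lambda>t. path_sum g (Graft s t)) = path_sum g s + g (Suc i) * P i" for s :: "unit rtree"
      proof -
        have "ua_mean i (\<lambda>t. path_sum g (Graft s t)) = ua_mean i (\<lambda>t. path_sum g s + g (Suc i) * path_sum g t)"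
          by (intro ua_mean_cong) simp
        thus ?thesis using less[of i] Suc that by (simp add: ua_mean_add ua_mean_const ua_mean_cmult P_def)
      qed
      thus ?thesis using less[of "m - i"] Suc by (simp add: ua_mean_add ua_mean_const P_def)
    qed
    hence "ua_mean n (path_sum g) = (\<Sum>i\<le>m. P (m - i) + g (Suc i) * P i) / real (Suc m)"
      unfolding Suc ua_mean_split by simp
    also have "(\<Sum>i\<le>m. P (m - i) + g (Suc i) * P i) = (\<Sum>i\<le>m. P i + g (Suc i) * P i)"
    proof -
      have "(\<Sum>i\<le>m. P (m - i)) = (\<Sum>i\<le>m. P i)"
        by (rule sum.reindex_bij_witness[of _ "\<lambda>i. m - i" "\<lambda>i. m - i"]) auto
      thus ?thesis by (simp add: sum.distrib)
    qed
    also have "\<dots> / real (Suc m) = P n"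
      unfolding P_sum Suc by simp
    finally show ?thesis unfolding P_def .
  qed simp
qed

text \<open>Independence of the two halves factorises the terms of the binomial expansion, and the
  induction hypothesis bounds each factor. \<open>N\<close> stays fixed while \<open>n\<close>
  decreases, because subtrees keep the weights of the whole tree; \<open>k\<close> has to vary,
  because lower moments occur in the expansion.\<close>

lemma ua_mean_path_sum_power:
  assumes p: "1 \<le> p" and N: "n < N" "k \<le> p"
  shows "ua_mean n (\<lambda>t. path_sum (\<lambda>a. root p (2 * real a / real N)) t ^ k)
           \<le> exp (72 * (real k * real (p + k) * root p (2 * real (Suc n) / real N)))"
  using N
proof (induction n arbitrary: k rule: less_induct)
  case (less n)
  define g where "g a = root p (2 * real a / real N)" for a
  define F where "F = (path_sum g :: unit rtree \<Rightarrow> real)"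
  have N0: "0 < real N" using less.prems by simp
  have g0: "0 \<le> g a" for a using p by (simp add: g_def real_root_ge_zero)
  have F0: "0 \<le> F t" for t unfolding F_def by (intro path_sum_nonneg g0)
  define B where "B j a = exp (72 * (real j * real (p + j) * g a))" for j a
  have IH: "ua_mean i (\<lambda>t. F t ^ j) \<le> B j (Suc i)" if "i < n" "j \<le> k" for i j
    using less.IH[of i j] that less.prems unfolding F_def g_def B_def by auto
  have "ua_mean n (\<lambda>t. F t ^ k) \<le> B k (Suc n)"
  proof (cases "n = 0 \<or> k = 0")
    case True
    have "1 \<le> B k (Suc n)" using g0 by (simp add: B_def)
    thus ?thesis using True by (auto simp: ua_mean_const F_def)
  next
    case False
    then obtain m where m: "n = Suc m" by (cases n) auto
    have k: "1 \<le> k" "k \<le> p" using False less.prems by auto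
    define w where "w = g (Suc n)"
    have w0: "0 \<le> w" by (simp add: w_def g0)
    \<comment> \<open>This rests on \<open>k \<le> p\<close>: the number under the root is at most
      2, and the \<open>k\<close>-th power at most undoes the root.\<close>
    have "w ^ k \<le> 2"
    proof -
      have "w \<le> root p 2"
        unfolding w_def g_def using p less.prems N0 by (auto simp: field_simps)
      hence "w ^ k \<le> root p 2 ^ k" using w0 by (intro power_mono)
      also have "\<dots> \<le> root p 2 ^ p" using k p by (intro power_increasing) auto
      also have "\<dots> = 2" using p by (intro real_root_pow_pos2) auto
      finally show ?thesis .
    qed
    \<comment> \<open>Homogeneity of the root turns shares of \<open>N\<close> into shares of the
      current size \<open>m + 2\<close>.\<close>
    have scale: "g a = w * root p (real a / real (m + 2))" for a
    proof -
      have "2 * real a / real N = 2 * x / real N * (real a / x)" if "x \<noteq> 0" for x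
        using that by simp
      from this[of "real (m + 2)"]
      have "2 * real a / real N = 2 * real (Suc n) / real N * (real a / real (m + 2))"
        by (simp add: m)
      thus ?thesis unfolding w_def g_def by (simp only: real_root_mult)
    qed
    have "ua_mean (m - i) (\<lambda>s. ua_mean i (\<lambda>t. F (Graft s t) ^ k))
       \<le> (\<Sum>j\<le>k. real (k choose j) * g (Suc i) ^ j * (B (k - j) (Suc (m - i)) * B j (Suc i)))"
      if i: "i \<le> m" for i
    proof -
      have "ua_mean i (\<lambda>t. F (Graft s t) ^ k)
          = (\<Sum>j\<le>k. real (k choose j) * g (Suc i) ^ j * ua_mean i (\<lambda>t. F t ^ j) * F s ^ (k - j))" for s
      proof -
        have "ua_mean i (\<lambda>t. F (Graft s t) ^ k)
            = ua_mean i (\<lambda>t. \<Sum>j\<le>k. (real (k choose j) * g (Suc i) ^ j * F s ^ (k - j)) * F t ^ j)"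
          by (intro ua_mean_cong)
             (simp add: F_def add.commute[of "path_sum g s"] binomial_ring power_mult_distrib mult_ac)
        also have "\<dots> = (\<Sum>j\<le>k. (real (k choose j) * g (Suc i) ^ j * F s ^ (k - j)) * ua_mean i (\<lambda>t. F t ^ j))"
          by (simp only: ua_mean_sum finite_atMost ua_mean_cmult)
        finally show ?thesis by (simp add: mult_ac)
      qed
      hence "ua_mean (m - i) (\<lambda>s. ua_mean i (\<lambda>t. F (Graft s t) ^ k))
          = (\<Sum>j\<le>k. real (k choose j) * g (Suc i) ^ j * ua_mean i (\<lambda>t. F t ^ j) * ua_mean (m - i) (\<lambda>s. F s ^ (k - j)))"
        by (simp add: ua_mean_sum ua_mean_cmult)
      also have "\<dots> = (\<Sum>j\<le>k. real (k choose j) * g (Suc i) ^ j * (ua_mean (m - i) (\<lambda>s. F s ^ (k - j)) * ua_mean i (\<lambda>t. F t ^ j)))"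
        by (simp add: mult_ac)
      also have "\<dots> \<le> (\<Sum>j\<le>k. real (k choose j) * g (Suc i) ^ j * (B (k - j) (Suc (m - i)) * B j (Suc i)))"
      proof (intro sum_mono mult_left_mono mult_mono)
        fix j assume "j \<in> {..k}"
        show "ua_mean (m - i) (\<lambda>s. F s ^ (k - j)) \<le> B (k - j) (Suc (m - i))"
          using m i by (intro IH) auto
        show "ua_mean i (\<lambda>t. F t ^ j) \<le> B j (Suc i)"
          using m i \<open>j \<in> {..k}\<close> by (intro IH) auto
        show "0 \<le> ua_mean i (\<lambda>t. F t ^ j)"
          using ua_mean_mono[of i "\<lambda>t. 0" "\<lambda>t. F t ^ j"] F0 by (simp add: ua_mean_const)
      qed (auto simp: B_def g0)
      finally show ?thesis .
    qed
    hence "ua_mean n (\<lambda>t. F t ^ k)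
       \<le> (\<Sum>i\<le>m. \<Sum>j\<le>k. real (k choose j) * g (Suc i) ^ j * (B (k - j) (Suc (m - i)) * B j (Suc i))) / real (Suc m)"
      unfolding m ua_mean_split by (intro divide_right_mono sum_mono) auto
    also have "\<dots> \<le> B k (Suc n)"
    proof -
      have "(\<Sum>i\<le>m. \<Sum>j\<le>k. real (k choose j) * g (Suc i) ^ j * (B (k - j) (Suc (m - i)) * B j (Suc i)))
          \<le> real (m + 1) * B k (Suc n)"
        using moment_recursion_sum_le[OF k w0 \<open>w ^ k \<le> 2\<close>, of m]
        unfolding B_def scale mult_exp_exp w_def[symmetric]
        using p by (simp add: scale[of "Suc n"] m distrib_left)
      thus ?thesis by (simp add: field_simps)
    qed
    finally show ?thesis .
  qed
  thus ?case unfolding F_def g_def B_def .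
qed

section \<open>Centrality along a path\<close>

fun rt_root :: "'a rtree \<Rightarrow> 'a" where
  "rt_root (Vertex x) = x"
| "rt_root (Graft a b) = rt_root a"

fun rt_arcs :: "'a rtree \<Rightarrow> ('a \<times> 'a) set" where
  "rt_arcs (Vertex x) = {}"
| "rt_arcs (Graft a b) = {(rt_root a, rt_root b), (rt_root b, rt_root a)} \<union> rt_arcs a \<union> rt_arcs b"

fun rt_distinct :: "'a rtree \<Rightarrow> bool" where
  "rt_distinct (Vertex x) \<longleftrightarrow> True"
| "rt_distinct (Graft a b) \<longleftrightarrow> rt_distinct a \<and> rt_distinct b \<and> set_rtree a \<inter> set_rtree b = {}"

definition rt_graph :: "'a rtree \<Rightarrow> 'a pair_pre_digraph" where
  "rt_graph t = \<lparr> pverts = set_rtree t, parcs = rt_arcs t \<rparr>"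

lemma rt_graph_simps [simp]:
  "pverts (rt_graph t) = set_rtree t" "parcs (rt_graph t) = rt_arcs t"
  by (simp_all add: rt_graph_def)

text \<open>Only meaningful if \<open>u\<close> and \<open>w\<close> are nodes of the tree.\<close>

fun rt_path :: "'a rtree \<Rightarrow> 'a \<Rightarrow> 'a \<Rightarrow> 'a list" where
  "rt_path (Vertex x) u w = [x]"
| "rt_path (Graft a b) u w =
     (if u \<in> set_rtree a
      then (if w \<in> set_rtree a then rt_path a u w else rt_path a u (rt_root a) @ rt_path b (rt_root b) w)
      else (if w \<in> set_rtree a then rt_path b u (rt_root b) @ rt_path a (rt_root a) w else rt_path b u w))"

section \<open>Paths in the graph of a shape and their uniqueness\<close>

lemma rt_root_in [simp]: "rt_root t \<in> set_rtree t"
  by (induction t) auto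

lemma rt_arcs_subset: "rt_arcs t \<subseteq> set_rtree t \<times> set_rtree t"
  by (induction t) auto

lemma rt_arcs_sym: "(u, v) \<in> rt_arcs t \<Longrightarrow> (v, u) \<in> rt_arcs t"
  by (induction t) auto

lemma rt_arcs_irrefl:
  assumes "rt_distinct t" "(u, v) \<in> rt_arcs t"
  shows "u \<noteq> v"
proof -
  have "rt_distinct t \<Longrightarrow> (u, u) \<notin> rt_arcs t" for u
  proof (induction t)
    case (Graft a b)
    hence "rt_root a \<noteq> rt_root b"
      by (metis rt_distinct.simps(2) disjoint_iff rt_root_in)
    thus ?case using Graft by auto
  qed simp
  thus ?thesis using assms by blast
qed

lemma finite_rt_arcs: "finite (rt_arcs t)"
  by (induction t) auto

lemma finite_set_rtree [simp]: "finite (set_rtree t)"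
  by (induction t) auto

lemma card_set_rtree: "rt_distinct t \<Longrightarrow> card (set_rtree t) = rt_size t"
  by (induction t) (auto simp: card_Un_disjoint)

lemma rt_path_basic:
  assumes "rt_distinct t" "u \<in> set_rtree t" "w \<in> set_rtree t"
  shows "rt_path t u w \<noteq> [] \<and> hd (rt_path t u w) = u \<and> last (rt_path t u w) = w \<and>
         set (rt_path t u w) \<subseteq> set_rtree t \<and> distinct (rt_path t u w) \<and>
         set (vwalk_arcs (rt_path t u w)) \<subseteq> rt_arcs t"
  using assms
proof (induction t arbitrary: u w)
  case (Graft a b)
  note IHa = Graft.IH(1) and IHb = Graft.IH(2)
  have d: "rt_distinct a" "rt_distinct b" "set_rtree a \<inter> set_rtree b = {}"
    using Graft.prems by auto
  consider "u \<in> set_rtree a" "w \<in> set_rtree a" | "u \<in> set_rtree a" "w \<in> set_rtree b" "w \<notin> set_rtree a"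
    | "u \<in> set_rtree b" "u \<notin> set_rtree a" "w \<in> set_rtree a"
    | "u \<in> set_rtree b" "u \<notin> set_rtree a" "w \<in> set_rtree b" "w \<notin> set_rtree a"
    using Graft.prems d by auto
  thus ?case
  proof cases
    case 1
    thus ?thesis using IHa[OF d(1) 1] by auto
  next
    case 2
    thus ?thesis using IHa[OF d(1) 2(1) rt_root_in] IHb[OF d(2) rt_root_in 2(2)] d(3)
      by (auto simp: vwalk_arcs_append)
  next
    case 3
    thus ?thesis using IHb[OF d(2) 3(1) rt_root_in] IHa[OF d(1) rt_root_in 3(3)] d(3)
      by (auto simp: vwalk_arcs_append)
  next
    case 4
    thus ?thesis using IHb[OF d(2) 4(1) 4(3)] by auto
  qed
qed simp

lemma rt_path_self:
  assumes "rt_distinct t" "u \<in> set_rtree t"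
  shows "rt_path t u u = [u]"
  using assms by (induction t) auto

text \<open>The induction step for the uniqueness of paths. If the arc is the grafting edge, the
  last premise forces \<open>w\<close> to lie on the side of \<open>x\<close>; any other arc lies
  inside one half.\<close>

lemma rt_path_Cons:
  assumes "rt_distinct t" "(u, x) \<in> rt_arcs t" "w \<in> set_rtree t" "u \<notin> set (rt_path t x w)"
  shows "rt_path t u w = u # rt_path t x w"
  using assms
proof (induction t arbitrary: w)
  case (Graft a b)
  have d: "rt_distinct a" "rt_distinct b" "set_rtree a \<inter> set_rtree b = {}"
    using Graft.prems by auto
  have notin: "v \<in> set_rtree b \<Longrightarrow> v \<notin> set_rtree a" for v using d(3) by auto
  have hd_in: "rt_distinct t \<Longrightarrow> v \<in> set_rtree t \<Longrightarrow> y \<in> set_rtree t \<Longrightarrow> v \<in> set (rt_path t v y)"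
    for t :: "'a rtree" and v y using rt_path_basic[of t v y] hd_in_set by metis
  consider "u = rt_root a" "x = rt_root b" | "u = rt_root b" "x = rt_root a"
    | "(u, x) \<in> rt_arcs a" | "(u, x) \<in> rt_arcs b"
    using Graft.prems by auto
  thus ?case
  proof cases
    case 1
    have w: "w \<in> set_rtree b"
    proof (rule ccontr)
      assume "w \<notin> set_rtree b"
      thus False using Graft.prems 1 notin[of "rt_root b"] hd_in[OF d(1) rt_root_in, of w] by auto
    qed
    thus ?thesis using 1 notin[of w] notin[of "rt_root b"] by (simp add: rt_path_self d)
  next
    case 2
    have w: "w \<in> set_rtree a"
    proof (rule ccontr)
      assume "w \<notin> set_rtree a"
      thus False using Graft.prems 2 hd_in[OF d(2) rt_root_in, of w] by auto
    qed
    thus ?thesis using 2 notin[of "rt_root b"] by (simp add: rt_path_self d)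
  next
    case 3
    hence "u \<in> set_rtree a" "x \<in> set_rtree a" using rt_arcs_subset[of a] by auto
    thus ?thesis using Graft.IH(1)[OF d(1) 3] Graft.prems by (auto split: if_splits)
  next
    case 4
    hence "u \<in> set_rtree b" "x \<in> set_rtree b" using rt_arcs_subset[of b] by auto
    thus ?thesis using Graft.IH(2)[OF d(2) 4] Graft.prems notin by (auto split: if_splits)
  qed
qed simp

lemma vpath_rt_path:
  assumes "rt_distinct t" "u \<in> set_rtree t" "w \<in> set_rtree t"
  shows "vpath (rt_path t u w) (with_proj (rt_graph t))"
  using rt_path_basic[OF assms] by (auto simp: vpath_def vwalk_def)

lemma vpath_unique:
  assumes "rt_distinct t" "vpath p (with_proj (rt_graph t))"
  shows "p = rt_path t (hd p) (last p)"
  using assms(2)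
proof (induction p)
  case Nil
  thus ?case by (auto simp: vpath_def vwalk_def)
next
  case (Cons u p)
  show ?case
  proof (cases "p = []")
    case True
    thus ?thesis using Cons.prems assms(1) by (auto simp: vpath_def vwalk_def rt_path_self)
  next
    case False
    have "vwalk p (with_proj (rt_graph t))" "(u, hd p) \<in> rt_arcs t" "last p \<in> set_rtree t" "u \<notin> set p"
      using Cons.prems False vwalk_consE[of u p "with_proj (rt_graph t)"]
      by (auto simp: vpath_def vwalk_def)
    moreover from this have "p = rt_path t (hd p) (last p)"
      using Cons by (auto simp: vpath_def)
    ultimately show ?thesis
      using rt_path_Cons[OF assms(1), of u "hd p" "last p"] False by auto
  qed
qed

lemma subtree_below_rt_graph:
  assumes "rt_distinct t" "u \<in> set_rtree t"
  shows "subtree_below (rt_graph t) u v = {w \<in> set_rtree t. v \<in> set (rt_path t u w)}"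
proof -
  have "(\<exists>p. vpath p (with_proj (rt_graph t)) \<and> hd p = u \<and> last p = w \<and> v \<in> set p)
          \<longleftrightarrow> v \<in> set (rt_path t u w)" if "w \<in> set_rtree t" for w
    using vpath_unique[OF assms(1)] vpath_rt_path[OF assms that] rt_path_basic[OF assms that]
    by metis
  thus ?thesis by (auto simp: subtree_below_def)
qed

lemma finite_tree_rt_graph:
  assumes "rt_distinct t"
  shows "finite_tree (rt_graph t)"
proof -
  let ?G = "rt_graph t"
  interpret pair_graph ?G
  proof unfold_locales
    show "fst e \<in> pverts ?G" "snd e \<in> pverts ?G" if "e \<in> parcs ?G" for e
      using that rt_arcs_subset[of t] by auto
    show "finite (pverts ?G)" "finite (parcs ?G)"
      by (auto simp: finite_rt_arcs)
    show "fst e \<noteq> snd e" if "e \<in> parcs ?G" for e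
      using that rt_arcs_irrefl[OF assms] by (cases e) auto
    show "symmetric (with_proj ?G)"
      by (auto simp: symmetric_def intro!: symI rt_arcs_sym)
  qed
  have "mk_symmetric (with_proj ?G) = ?G"
    by (auto simp: mk_symmetric_def rt_graph_def dest: rt_arcs_sym)
  moreover have "reachable (with_proj ?G) (hd p) (last p)" if "vwalk p (with_proj ?G)" for p
    using that
  proof (induction p rule: vwalk_induct)
    case (Cons u v es)
    thus ?case using adj_reachable_trans[of u v] by auto
  qed auto
  hence "reachable (with_proj ?G) u v" if "u \<in> set_rtree t" "v \<in> set_rtree t" for u v
    using vpath_rt_path[OF assms that] rt_path_basic[OF assms that] by (metis vpathE)
  moreover have "set_rtree t \<noteq> {}"
    using rt_root_in by (metis empty_iff)
  ultimately have "Digraph_Component.connected (with_proj ?G)"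
    by (simp add: Digraph_Component.connected_def strongly_connected_def)
  \<comment> \<open>A cycle that leaves \<open>u\<close> along \<open>e\<close> returns by a path
    from \<open>snd e\<close> to \<open>u\<close>. The reverse of \<open>e\<close> is such a path
    too, so by uniqueness the cycle has length 2.\<close>
  moreover have False if cyc: "pre_digraph.cycle (with_proj ?G) p" and len: "length p \<ge> 3" for p
  proof -
    obtain u where u: "awalk u p u" "distinct (tl (pawalk_verts u p))" "p \<noteq> []"
      using cyc by (auto simp: cycle_def)
    obtain e q where p: "p = e # q" using u(3) by (cases p) auto
    have e: "e \<in> rt_arcs t" "fst e = u" and q: "awalk (snd e) q u" "distinct (pawalk_verts (snd e) q)"
      using u by (auto simp: p awalk_Cons_iff)
    let ?q = "pawalk_verts (snd e) q"
    have "vwalk ?q (with_proj ?G)" using awalk_imp_vwalk[OF q(1)] by simp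
    hence "?q = rt_path t (hd ?q) (last ?q)"
      using vpath_unique[OF assms, of ?q] q(2) by (auto simp: vpath_def)
    moreover have "hd ?q = snd e" "last ?q = u" using q(1) by (auto elim!: awalkE)
    ultimately have q_eq: "?q = rt_path t (snd e) u" by metis
    have ue: "(u, snd e) \<in> rt_arcs t" using e by (cases e) auto
    have "vpath [snd e, u] (with_proj ?G)"
      using ue rt_arcs_subset[of t] rt_arcs_irrefl[OF assms ue] rt_arcs_sym[OF ue]
      by (auto simp: vpath_def vwalk_def)
    hence "[snd e, u] = ?q" using vpath_unique[OF assms, of "[snd e, u]"] q_eq by simp
    moreover have "length ?q = Suc (length q)" using length_awalk_verts[of "snd e" q] by simp
    ultimately have "Suc (length q) = 2" by (metis length_Cons list.size(3) numeral_2_eq_2)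
    thus False using len p by simp
  qed
  ultimately show ?thesis
    unfolding finite_tree_def using pair_graph by blast
qed

text \<open>One of the two paths is the other with an end of the edge prepended, so they agree on
  all remaining nodes.\<close>

lemma rt_path_adjacent:
  assumes "rt_distinct t" "(u, x) \<in> rt_arcs t" "w \<in> set_rtree t"
  shows "x \<in> set (rt_path t u w) \<longleftrightarrow> u \<notin> set (rt_path t x w)"
    and "v \<noteq> u \<Longrightarrow> v \<noteq> x \<Longrightarrow> v \<in> set (rt_path t u w) \<longleftrightarrow> v \<in> set (rt_path t x w)"
proof -
  have ux: "u \<in> set_rtree t" "x \<in> set_rtree t" "u \<noteq> x"
    using assms rt_arcs_subset[of t] rt_arcs_irrefl[OF assms(1,2)] by auto
  note bx = rt_path_basic[OF assms(1) ux(2) assms(3)] and bu = rt_path_basic[OF assms(1) ux(1) assms(3)]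
  have xu: "(x, u) \<in> rt_arcs t" using assms(2) by (rule rt_arcs_sym)
  have one: "x \<notin> set (rt_path t u w)" if u: "u \<in> set (rt_path t x w)"
  proof -
    obtain ys zs where yz: "rt_path t x w = ys @ u # zs" using u by (meson split_list)
    have "vpath (ys @ u # zs) (with_proj (rt_graph t))"
      using vpath_rt_path[OF assms(1) ux(2) assms(3)] yz by simp
    hence "vpath (u # zs) (with_proj (rt_graph t))"
      by (auto simp: vpath_def intro: vwalkI_append_r)
    moreover have "last (u # zs) = w" using bx yz by (metis last_appendR list.discI)
    ultimately have "u # zs = rt_path t u w"
      using vpath_unique[OF assms(1), of "u # zs"] by (metis list.sel(1))
    moreover have "x \<in> set ys" using bx yz ux(3) by (cases ys) auto
    moreover have "distinct (ys @ u # zs)" using bx yz by metis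
    ultimately show ?thesis by (metis IntI distinct_append empty_iff)
  qed
  have hd: "x \<in> set (rt_path t x w)" using bx by (metis hd_in_set)
  show "x \<in> set (rt_path t u w) \<longleftrightarrow> u \<notin> set (rt_path t x w)"
    using one rt_path_Cons[OF assms(1,2,3)] hd by (metis list.set_intros(2))
  show "v \<in> set (rt_path t u w) \<longleftrightarrow> v \<in> set (rt_path t x w)" if "v \<noteq> u" "v \<noteq> x"
    using one rt_path_Cons[OF assms(1,2,3)] rt_path_Cons[OF assms(1) xu assms(3)] that
    by (metis set_ConsD list.set_intros(2))
qed

section \<open>The change of centrality across an edge\<close>

lemma centrality_pos:
  assumes "rt_distinct t" "u \<in> set_rtree t"
  shows "0 < centrality (rt_graph t) u"
proof -
  have "v \<in> subtree_below (rt_graph t) u v" if "v \<in> set_rtree t" for v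
    using rt_path_basic[OF assms that] that
    by (auto simp: subtree_below_rt_graph[OF assms]) (metis last_in_set)
  moreover have "finite (subtree_below (rt_graph t) u v)" for v
    by (simp add: subtree_below_rt_graph[OF assms])
  ultimately show ?thesis
    by (auto simp: centrality_def card_gt_0_iff intro!: prod_pos)
qed

text \<open>Rerooting from \<open>u\<close> to \<open>x\<close> replaces the factor \<open>s\<close>
  of \<open>x\<close> by the complementary size for \<open>u\<close>; all other hanging subtrees
  stay the same. The ratio is multiplied out to remain in the natural numbers.\<close>

lemma centrality_adjacent:
  assumes t: "rt_distinct t" and ux: "(u, x) \<in> rt_arcs t"
  defines "s \<equiv> card (subtree_below (rt_graph t) u x)"
  shows "centrality (rt_graph t) x * s = centrality (rt_graph t) u * (rt_size t - s)"
proof -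
  have mem: "u \<in> set_rtree t" "x \<in> set_rtree t" "u \<noteq> x"
    using t ux rt_arcs_subset[of t] rt_arcs_irrefl[OF t ux] by auto
  note sb = subtree_below_rt_graph[OF t mem(1)] subtree_below_rt_graph[OF t mem(2)]
  define R where "R = (\<Prod>v\<in>set_rtree t - {u, x}. card (subtree_below (rt_graph t) u v))"
  have R': "R = (\<Prod>v\<in>set_rtree t - {u, x}. card (subtree_below (rt_graph t) x v))"
    unfolding R_def
  proof (intro prod.cong refl)
    fix v assume "v \<in> set_rtree t - {u, x}"
    hence "subtree_below (rt_graph t) u v = subtree_below (rt_graph t) x v"
      using rt_path_adjacent(2)[OF t ux, of _ v] by (auto simp: sb)
    thus "card (subtree_below (rt_graph t) u v) = card (subtree_below (rt_graph t) x v)" by simp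
  qed
  have "subtree_below (rt_graph t) x u = set_rtree t - subtree_below (rt_graph t) u x"
    using rt_path_adjacent(1)[OF t ux] by (auto simp: sb)
  hence c: "card (subtree_below (rt_graph t) x u) = rt_size t - s"
    unfolding s_def by (simp add: card_Diff_subset sb card_set_rtree[OF t])
  have "centrality (rt_graph t) u = s * R"
    unfolding centrality_def s_def R_def using mem
    by (subst prod.remove[of _ x]) (auto intro!: prod.cong)
  moreover have "centrality (rt_graph t) x = (rt_size t - s) * R"
    unfolding centrality_def c[symmetric] R' using mem
    by (subst prod.remove[of _ u]) (auto intro!: prod.cong)
  ultimately show ?thesis by simp
qed

section \<open>Hanging subtrees and centrality along root paths\<close>

text \<open>In a part \<open>Graft a b\<close> of a tree with distinct labels, \<open>b\<close> is a
  complete hanging subtree of the whole tree, whereas \<open>a\<close> may lack branches at its root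
  that are grafted further out.\<close>

fun rt_parts :: "'a rtree \<Rightarrow> 'a rtree set" where
  "rt_parts (Vertex x) = {Vertex x}"
| "rt_parts (Graft a b) = insert (Graft a b) (rt_parts a \<union> rt_parts b)"

lemma rt_parts_self [simp]: "t \<in> rt_parts t"
  by (cases t) auto

lemma rt_parts_trans: "s \<in> rt_parts t \<Longrightarrow> r \<in> rt_parts s \<Longrightarrow> r \<in> rt_parts t"
  by (induction t) auto

lemma rt_parts_subset: "s \<in> rt_parts t \<Longrightarrow> set_rtree s \<subseteq> set_rtree t"
  by (induction t) auto

lemma rt_parts_distinct: "s \<in> rt_parts t \<Longrightarrow> rt_distinct t \<Longrightarrow> rt_distinct s"
  by (induction t) auto

lemma rt_parts_arc: "Graft a b \<in> rt_parts t \<Longrightarrow> (rt_root a, rt_root b) \<in> rt_arcs t"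
  by (induction t) auto

lemma rt_root_notin_part:
  "Graft a b \<in> rt_parts t \<Longrightarrow> rt_distinct t \<Longrightarrow> rt_root t \<notin> set_rtree b"
proof (induction t)
  case (Graft A B)
  then consider "a = A" "b = B" | "Graft a b \<in> rt_parts A" | "Graft a b \<in> rt_parts B" by auto
  thus ?case
  proof cases
    case 3
    have "rt_root A \<notin> set_rtree B"
      using Graft.prems by (metis rt_distinct.simps(2) disjoint_iff rt_root_in)
    thus ?thesis using rt_parts_subset[OF 3] by auto
  next
    case 1
    thus ?thesis using Graft.prems by (metis rt_root.simps(2) rt_distinct.simps(2) disjoint_iff rt_root_in)
  qed (use Graft in auto)
qed simp

text \<open>A path between the two halves passes through the root of the half that contains the
  part. By \<open>rt_root_notin_part\<close> that root is outside \<open>b\<close>, so the induction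
  hypothesis for it shows that the path misses \<open>rt_root b\<close>.\<close>

lemma rt_path_part:
  assumes "Graft a b \<in> rt_parts t" "rt_distinct t" "w \<in> set_rtree t"
  shows "rt_root b \<in> set (rt_path t (rt_root a) w) \<longleftrightarrow> w \<in> set_rtree b"
  using assms
proof (induction t arbitrary: w)
  case (Graft A B)
  have d: "rt_distinct A" "rt_distinct B" "set_rtree A \<inter> set_rtree B = {}"
    using Graft.prems by auto
  consider "a = A" "b = B" | "Graft a b \<in> rt_parts A" | "Graft a b \<in> rt_parts B" "Graft a b \<notin> rt_parts A"
    using Graft.prems by auto
  thus ?case
  proof cases
    case 1
    show ?thesis
    proof (cases "w \<in> set_rtree A")
      case True
      thus ?thesis using 1 rt_path_basic[OF d(1) rt_root_in True] rt_root_in[of B] d(3) by auto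
    next
      case False
      hence w: "w \<in> set_rtree B" using Graft.prems by auto
      have "rt_root B \<in> set (rt_path B (rt_root B) w)"
        using rt_path_basic[OF d(2) rt_root_in w] by (metis hd_in_set)
      thus ?thesis using 1 False w by simp
    qed
  next
    case 2
    have sub: "set_rtree a \<subseteq> set_rtree A" "set_rtree b \<subseteq> set_rtree A"
      using rt_parts_subset[OF 2] by auto
    have ra: "rt_root a \<in> set_rtree A" and rb: "rt_root b \<in> set_rtree A" using sub rt_root_in by blast+
    show ?thesis
    proof (cases "w \<in> set_rtree A")
      case True
      thus ?thesis using Graft.IH(1)[OF 2 d(1)] ra by simp
    next
      case False
      hence w: "w \<in> set_rtree B" using Graft.prems by auto
      have "rt_root b \<notin> set (rt_path B (rt_root B) w)"
        using rt_path_basic[OF d(2) rt_root_in w] rb d(3) by auto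
      moreover have "w \<notin> set_rtree b" using w sub d(3) by auto
      ultimately show ?thesis
        using False ra Graft.IH(1)[OF 2 d(1) rt_root_in] rt_root_notin_part[OF 2 d(1)] by simp
    qed
  next
    case 3
    have sub: "set_rtree a \<subseteq> set_rtree B" "set_rtree b \<subseteq> set_rtree B"
      using rt_parts_subset[OF 3(1)] by auto
    have ra: "rt_root a \<in> set_rtree B" and rb: "rt_root b \<in> set_rtree B" using sub rt_root_in by blast+
    hence ra': "rt_root a \<notin> set_rtree A" "rt_root b \<notin> set_rtree A" using d(3) by auto
    show ?thesis
    proof (cases "w \<in> set_rtree A")
      case False
      hence w: "w \<in> set_rtree B" using Graft.prems by auto
      show ?thesis using Graft.IH(2)[OF 3(1) d(2) w] ra' False by simp
    next
      case True
      have "rt_root b \<notin> set (rt_path A (rt_root A) w)"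
        using rt_path_basic[OF d(1) rt_root_in True] ra'(2) by auto
      moreover have "w \<notin> set_rtree b" using True sub d(3) by auto
      ultimately show ?thesis
        using True ra' Graft.IH(2)[OF 3(1) d(2) rt_root_in] rt_root_notin_part[OF 3(1) d(2)] by simp
    qed
  qed
qed simp

text \<open>The term of \<^const>\<open>path_sum\<close> that belongs to the node \<open>v\<close>.\<close>

fun path_prod :: "(nat \<Rightarrow> real) \<Rightarrow> 'a rtree \<Rightarrow> 'a \<Rightarrow> real" where
  "path_prod g (Vertex x) v = 1"
| "path_prod g (Graft a b) v = (if v \<in> set_rtree a then path_prod g a v else g (rt_size b) * path_prod g b v)"

lemma path_sum_eq_sum_path_prod:
  assumes "rt_distinct t"
  shows "path_sum g t = (\<Sum>v\<in>set_rtree t. path_prod g t v)"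
  using assms
proof (induction t)
  case (Graft a b)
  have "(\<Sum>v\<in>set_rtree (Graft a b). path_prod g (Graft a b) v)
      = (\<Sum>v\<in>set_rtree a. path_prod g (Graft a b) v) + (\<Sum>v\<in>set_rtree b. path_prod g (Graft a b) v)"
    using Graft.prems by (simp add: sum.union_disjoint)
  also have "(\<Sum>v\<in>set_rtree b. path_prod g (Graft a b) v) = (\<Sum>v\<in>set_rtree b. g (rt_size b) * path_prod g b v)"
    using Graft.prems by (intro sum.cong) auto
  finally show ?case using Graft by (simp add: sum_distrib_left)
qed simp

text \<open>\<open>centrality_adjacent\<close> telescoped along the path from
  \<open>rt_root t\<close> to \<open>v\<close>. The induction runs over the parts of a fixed
  \<open>T\<close>, because the ratios refer to the size of \<open>T\<close>.\<close>

lemma centrality_part: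
  assumes T: "rt_distinct T" and t: "t \<in> rt_parts T" "v \<in> set_rtree t"
  shows "real (centrality (rt_graph T) v)
       = path_prod (\<lambda>s. (real (rt_size T) - real s) / real s) t v * real (centrality (rt_graph T) (rt_root t))"
  using t
proof (induction t)
  case (Graft a b)
  let ?g = "\<lambda>s. (real (rt_size T) - real s) / real s"
  have ab: "a \<in> rt_parts T" "b \<in> rt_parts T"
    using rt_parts_trans[OF Graft.prems(1)] by auto
  show ?case
  proof (cases "v \<in> set_rtree a")
    case True
    thus ?thesis using Graft.IH(1)[OF ab(1) True] by simp
  next
    case False
    hence v: "v \<in> set_rtree b" using Graft.prems by auto
    note arc = rt_parts_arc[OF Graft.prems(1)]
    have "subtree_below (rt_graph T) (rt_root a) (rt_root b) = set_rtree b"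
      using rt_path_part[OF Graft.prems(1) T] rt_parts_subset[OF ab(1)] rt_parts_subset[OF ab(2)] rt_root_in[of a]
      by (subst subtree_below_rt_graph[OF T]) auto
    hence card: "card (subtree_below (rt_graph T) (rt_root a) (rt_root b)) = rt_size b"
      using card_set_rtree[OF rt_parts_distinct[OF ab(2) T]] by simp
    have "rt_size b \<le> rt_size T"
      using card_mono[OF _ rt_parts_subset[OF ab(2)]] card_set_rtree[OF T]
        card_set_rtree[OF rt_parts_distinct[OF ab(2) T]] by simp
    hence "real (centrality (rt_graph T) (rt_root b)) * real (rt_size b)
        = real (centrality (rt_graph T) (rt_root a)) * (real (rt_size T) - real (rt_size b))"
      using centrality_adjacent[OF T arc] unfolding card
      by (metis of_nat_diff of_nat_mult)
    hence "real (centrality (rt_graph T) (rt_root b)) = ?g (rt_size b) * real (centrality (rt_graph T) (rt_root a))"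
      by (simp add: field_simps)
    thus ?thesis using Graft.IH(2)[OF ab(2) v] False by simp
  qed
qed simp

section \<open>The law of the uniform attachment tree\<close>

fun rt_attach :: "'a \<Rightarrow> 'a \<Rightarrow> 'a rtree \<Rightarrow> 'a rtree" where
  "rt_attach w v (Vertex x) = (if x = v then Graft (Vertex x) (Vertex w) else Vertex x)"
| "rt_attach w v (Graft a b) = Graft (rt_attach w v a) (rt_attach w v b)"

lemma rt_attach_notin: "v \<notin> set_rtree t \<Longrightarrow> rt_attach w v t = t"
  by (induction t) auto

lemma rt_root_attach [simp]: "rt_root (rt_attach w v t) = rt_root t"
  by (induction t) auto

lemma set_rt_attach: "v \<in> set_rtree t \<Longrightarrow> set_rtree (rt_attach w v t) = insert w (set_rtree t)"
proof (induction t)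
  case (Graft a b)
  thus ?case
    by (cases "v \<in> set_rtree a"; cases "v \<in> set_rtree b") (auto simp: rt_attach_notin)
qed auto

lemma rt_distinct_attach:
  "rt_distinct t \<Longrightarrow> w \<notin> set_rtree t \<Longrightarrow> rt_distinct (rt_attach w v t)"
proof (induction t)
  case (Graft a b)
  consider "v \<in> set_rtree a" "v \<notin> set_rtree b" | "v \<in> set_rtree b" "v \<notin> set_rtree a"
    | "v \<notin> set_rtree a" "v \<notin> set_rtree b"
    using Graft.prems by auto
  thus ?case using Graft by cases (auto simp: rt_attach_notin set_rt_attach)
qed auto

lemma rt_arcs_attach:
  "rt_distinct t \<Longrightarrow> v \<in> set_rtree t \<Longrightarrow> rt_arcs (rt_attach w v t) = {(v, w), (w, v)} \<union> rt_arcs t"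
proof (induction t)
  case (Graft a b)
  consider "v \<in> set_rtree a" "v \<notin> set_rtree b" | "v \<in> set_rtree b" "v \<notin> set_rtree a"
    using Graft.prems by auto
  thus ?case using Graft by cases (auto simp: rt_attach_notin)
qed auto

lemma rt_graph_attach:
  "rt_distinct t \<Longrightarrow> v \<in> set_rtree t \<Longrightarrow> rt_graph (rt_attach w v t) = attach_node w v (rt_graph t)"
  by (simp add: rt_graph_def attach_node_def set_rt_attach rt_arcs_attach)

abbreviation rt_shape :: "'a rtree \<Rightarrow> unit rtree" where
  "rt_shape \<equiv> map_rtree (\<lambda>_. ())"

lemma rt_size_map [simp]: "rt_size (map_rtree f t) = rt_size t"
  by (induction t) auto

lemma path_sum_map [simp]: "path_sum g (map_rtree f t) = path_sum g t"
  by (induction t) auto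

text \<open>The link between attachment to a labelled node and \<open>leaf_sum\<close>: as labels
  are distinct, only the half containing \<open>v\<close> changes.\<close>

lemma sum_rt_attach:
  assumes "rt_distinct t"
  shows "(\<Sum>v\<in>set_rtree t. f (rt_shape (rt_attach w v t))) = leaf_sum f (rt_shape t)"
  using assms
proof (induction t arbitrary: f)
  case (Graft a b)
  have a_notin: "v \<in> set_rtree a \<Longrightarrow> v \<notin> set_rtree b" and b_notin: "v \<in> set_rtree b \<Longrightarrow> v \<notin> set_rtree a" for v
    using Graft.prems by auto
  have "(\<Sum>v\<in>set_rtree (Graft a b). f (rt_shape (rt_attach w v (Graft a b))))
     = (\<Sum>v\<in>set_rtree a. f (rt_shape (rt_attach w v (Graft a b))))
       + (\<Sum>v\<in>set_rtree b. f (rt_shape (rt_attach w v (Graft a b))))"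
    using Graft.prems by (simp add: sum.union_disjoint)
  also have "(\<Sum>v\<in>set_rtree a. f (rt_shape (rt_attach w v (Graft a b))))
     = (\<Sum>v\<in>set_rtree a. f (Graft (rt_shape (rt_attach w v a)) (rt_shape b)))"
    using a_notin by (intro sum.cong refl) (simp add: rt_attach_notin)
  also have "\<dots> = leaf_sum (\<lambda>s. f (Graft s (rt_shape b))) (rt_shape a)"
    using Graft.prems by (intro Graft.IH(1)) auto
  also have "(\<Sum>v\<in>set_rtree b. f (rt_shape (rt_attach w v (Graft a b))))
     = (\<Sum>v\<in>set_rtree b. f (Graft (rt_shape a) (rt_shape (rt_attach w v b))))"
    using b_notin by (intro sum.cong refl) (simp add: rt_attach_notin)
  also have "\<dots> = leaf_sum (\<lambda>s. f (Graft (rt_shape a) s)) (rt_shape b)"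
    using Graft.prems by (intro Graft.IH(2)) auto
  finally show ?case by simp
qed simp

text \<open>As for \<open>ua_mean\<close>, the index is one less than the number of nodes, so the
  step to \<open>Suc n\<close> adds the node \<open>n + 2\<close>. The value records the order of
  the grafts, which \<open>rt_graph\<close> forgets.\<close>

fun ua_rtree :: "nat \<Rightarrow> nat rtree pmf" where
  "ua_rtree 0 = return_pmf (Vertex 1)"
| "ua_rtree (Suc n) =
     do {
       t \<leftarrow> ua_rtree n;
       v \<leftarrow> pmf_of_set (set_rtree t);
       return_pmf (rt_attach (Suc (Suc n)) v t)
     }"

lemma set_rtree_nonempty [simp]: "set_rtree t \<noteq> {}"
  using rt_root_in[of t] by fastforce

lemma set_pmf_ua_rtree:
  assumes "t \<in> set_pmf (ua_rtree n)"
  shows "rt_distinct t" "set_rtree t = {1..Suc n}" "rt_root t = 1"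
proof -
  have "rt_distinct t \<and> set_rtree t = {1..Suc n} \<and> rt_root t = 1"
    using assms
  proof (induction n arbitrary: t)
    case (Suc n)
    then obtain s v where s: "s \<in> set_pmf (ua_rtree n)" "v \<in> set_rtree s"
      and t: "t = rt_attach (Suc (Suc n)) v s" by auto
    from Suc.IH[OF s(1)] s(2) show ?case
      unfolding t by (auto simp: set_rt_attach rt_distinct_attach)
  qed auto
  thus "rt_distinct t" "set_rtree t = {1..Suc n}" "rt_root t = 1" by auto
qed

lemma finite_set_pmf_ua_rtree: "finite (set_pmf (ua_rtree n))"
  by (induction n) auto

lemma uniform_attachment_eq_map_ua_rtree:
  "uniform_attachment (Suc n) = map_pmf rt_graph (ua_rtree n)"
proof (induction n)
  case 0
  show ?case by (simp add: rt_graph_def)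
next
  case (Suc n)
  have "uniform_attachment (Suc (Suc n)) = ua_rtree n \<bind> (\<lambda>t. pmf_of_set (set_rtree t) \<bind>
          (\<lambda>v. return_pmf (attach_node (Suc (Suc n)) v (rt_graph t))))"
    by (simp add: Suc bind_map_pmf)
  also have "\<dots> = ua_rtree n \<bind> (\<lambda>t. pmf_of_set (set_rtree t) \<bind>
          (\<lambda>v. return_pmf (rt_graph (rt_attach (Suc (Suc n)) v t))))"
    by (intro bind_pmf_cong refl) (auto simp: rt_graph_attach set_pmf_ua_rtree(1))
  also have "\<dots> = map_pmf rt_graph (ua_rtree (Suc n))"
    by (simp add: map_bind_pmf)
  finally show ?case .
qed

text \<open>Averaging over the chosen node turns \<open>f\<close> into \<open>leaf_sum f\<close>
  divided by the number of nodes, which is the recursion of \<open>ua_mean\<close>.\<close>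

lemma expectation_ua_rtree:
  "measure_pmf.expectation (ua_rtree n) (\<lambda>t. f (rt_shape t)) = ua_mean n f"
proof (induction n arbitrary: f)
  case (Suc n)
  let ?S = "set_pmf (ua_rtree n)"
  have "measure_pmf.expectation (ua_rtree (Suc n)) (\<lambda>t. f (rt_shape t))
     = (\<Sum>t\<in>?S. pmf (ua_rtree n) t *\<^sub>R measure_pmf.expectation
          (pmf_of_set (set_rtree t) \<bind> (\<lambda>v. return_pmf (rt_attach (Suc (Suc n)) v t))) (\<lambda>t. f (rt_shape t)))"
    unfolding ua_rtree.simps
    by (rule pmf_expectation_bind) (auto simp: finite_set_pmf_ua_rtree)
  also have "\<dots> = (\<Sum>t\<in>?S. pmf (ua_rtree n) t *\<^sub>R (leaf_sum f (rt_shape t) / real (Suc n)))"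
  proof (intro sum.cong refl arg_cong2[of _ _ _ _ scaleR])
    fix t assume t: "t \<in> ?S"
    have "measure_pmf.expectation (pmf_of_set (set_rtree t) \<bind> (\<lambda>v. return_pmf (rt_attach (Suc (Suc n)) v t)))
            (\<lambda>t. f (rt_shape t))
        = (\<Sum>v\<in>set_rtree t. f (rt_shape (rt_attach (Suc (Suc n)) v t)) /\<^sub>R real (card (set_rtree t)))"
      by (subst pmf_expectation_bind_pmf_of_set) auto
    also have "\<dots> = (\<Sum>v\<in>set_rtree t. f (rt_shape (rt_attach (Suc (Suc n)) v t))) / real (Suc n)"
      unfolding set_pmf_ua_rtree(2)[OF t] sum_divide_distrib
      by (intro sum.cong refl) (simp add: field_simps)
    also have "\<dots> = leaf_sum f (rt_shape t) / real (Suc n)"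
      by (simp add: sum_rt_attach set_pmf_ua_rtree(1)[OF t])
    finally show "measure_pmf.expectation (pmf_of_set (set_rtree t) \<bind> (\<lambda>v. return_pmf (rt_attach (Suc (Suc n)) v t)))
            (\<lambda>t. f (rt_shape t)) = leaf_sum f (rt_shape t) / real (Suc n)" .
  qed
  also have "\<dots> = measure_pmf.expectation (ua_rtree n) (\<lambda>t. leaf_sum f (rt_shape t) / real (Suc n))"
    by (rule integral_measure_pmf[symmetric]) (auto simp: finite_set_pmf_ua_rtree)
  also have "\<dots> = ua_mean n (\<lambda>t. leaf_sum f t / real (Suc n))"
    by (rule Suc)
  also have "\<dots> = ua_mean (Suc n) f"
    using ua_mean_cmult[of n "1 / real (Suc n)" "leaf_sum f"] by simp
  finally show ?case .
qed simp

lemma prob_ua_rtree_le: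
  assumes "\<And>t. t \<in> set_pmf (ua_rtree n) \<Longrightarrow> t \<in> E \<Longrightarrow> 1 \<le> f (rt_shape t)" "\<And>s. 0 \<le> f s"
  shows "measure_pmf.prob (ua_rtree n) E \<le> ua_mean n f"
proof -
  have "measure_pmf.prob (ua_rtree n) E = measure_pmf.expectation (ua_rtree n) (indicator E)"
    by simp
  also have "\<dots> \<le> measure_pmf.expectation (ua_rtree n) (\<lambda>t. f (rt_shape t))"
    using assms
    by (intro integral_mono_AE integrable_measure_pmf_finite finite_set_pmf_ua_rtree)
       (auto simp: AE_measure_pmf_iff indicator_def)
  also have "\<dots> = ua_mean n f" by (rule expectation_ua_rtree)
  finally show ?thesis .
qed

section \<open>Counting central nodes\<close>

lemma path_prod_mult: "path_prod (\<lambda>s. g s * h s) t v = path_prod g t v * path_prod h t v"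
  by (induction t) auto

lemma path_prod_inverse: "path_prod (\<lambda>s. inverse (g s)) t v = inverse (path_prod g t v)"
  by (induction t) auto

lemma path_prod_root:
  "0 < p \<Longrightarrow> path_prod (\<lambda>s. root p (g s)) t v = root p (path_prod g t v)"
  by (induction t) (auto simp: real_root_mult)

lemma path_prod_nonneg:
  assumes "\<And>s. 0 \<le> g s"
  shows "0 \<le> path_prod g t v"
  using assms by (induction t) auto

lemma path_prod_mono:
  assumes "\<And>s. 1 \<le> s \<Longrightarrow> s < rt_size t \<Longrightarrow> 0 \<le> g s \<and> g s \<le> h s"
  shows "0 \<le> path_prod g t v \<and> path_prod g t v \<le> path_prod h t v"
  using assms
proof (induction t)
  case (Graft a b)
  have "0 \<le> path_prod g a v \<and> path_prod g a v \<le> path_prod h a v"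
    "0 \<le> path_prod g b v \<and> path_prod g b v \<le> path_prod h b v"
    using Graft by auto
  moreover have "0 \<le> g (rt_size b) \<and> g (rt_size b) \<le> h (rt_size b)"
    by (intro Graft.prems) (auto simp: Suc_le_eq)
  ultimately show ?case by (auto intro!: mult_mono)
qed simp

lemma path_sum_ge_1:
  assumes "\<And>n. 0 \<le> g n"
  shows "1 \<le> path_sum g t"
proof (induction t)
  case (Graft a b)
  have "0 \<le> g (rt_size b) * path_sum g b"
    using assms Graft.IH by (intro mult_nonneg_nonneg) auto
  thus ?case using Graft.IH by simp
qed simp

text \<open>Each step to a node whose subtree has \<open>s\<close> of the \<open>N\<close> nodes divides the centrality by \<open>s / (N - s)\<close>.
  This exceeds 1 only on the path from the root to the centroid.\<close>

definition heavy_odds :: "nat \<Rightarrow> nat \<Rightarrow> real" where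
  "heavy_odds N s = (if N < 2 * s \<and> s < N then real s / (real N - real s) else 0)"

lemma heavy_odds_nonneg: "0 \<le> heavy_odds N s"
  by (simp add: heavy_odds_def)

lemma heavy_odds_ge_1: "N < 2 * s \<Longrightarrow> s < N \<Longrightarrow> 1 \<le> heavy_odds N s"
  by (simp add: heavy_odds_def field_simps)

text \<open>Ancestors of heavy nodes are heavy or the root, so the product is the single term of
  \<open>path_sum\<close> that belongs to the last heavy node on the path to \<open>v\<close> (or to
  the root); the other terms are nonnegative. The sum is preferred as a bound because its mean is
  explicit. The second conjunct stops the product at the first light node.\<close>

lemma path_prod_heavy_odds_le:
  assumes "rt_size t \<le> N"
  shows "path_prod (\<lambda>s. max 1 (sqrt (heavy_odds N s))) t v \<le> path_sum (\<lambda>s. sqrt (heavy_odds N s)) t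
       \<and> (2 * rt_size t \<le> N \<longrightarrow> path_prod (\<lambda>s. max 1 (sqrt (heavy_odds N s))) t v = 1)"
  using assms
proof (induction t)
  case (Graft a b)
  let ?g = "\<lambda>s. sqrt (heavy_odds N s)"
  have b: "rt_size b < N" using Graft.prems rt_size_pos[of a] unfolding rt_size.simps by linarith
  have sz: "rt_size a \<le> N" "rt_size b \<le> N" using Graft.prems by auto
  note IH = Graft.IH(1)[OF sz(1)] Graft.IH(2)[OF sz(2)]
  have g0: "0 \<le> ?g s" for s by (simp add: heavy_odds_nonneg)
  have ge: "1 \<le> path_sum ?g a" "1 \<le> path_sum ?g b" using path_sum_ge_1[of ?g, OF g0] by auto
  have prod_nonneg: "0 \<le> ?g (rt_size b) * path_sum ?g b"
    using g0 ge by (intro mult_nonneg_nonneg) auto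
  show ?case
  proof (cases "v \<in> set_rtree a")
    case True
    thus ?thesis using IH prod_nonneg by auto
  next
    case False
    show ?thesis
    proof (cases "N < 2 * rt_size b")
      case True
      hence "max 1 (?g (rt_size b)) = ?g (rt_size b)"
        using heavy_odds_ge_1[OF True b] by simp
      thus ?thesis using True False IH ge mult_left_mono[OF conjunct1[OF IH(2)] g0[of "rt_size b"]] by auto
    next
      case light: False
      hence "max 1 (?g (rt_size b)) = 1" by (simp add: heavy_odds_def)
      thus ?thesis using False light IH ge prod_nonneg by auto
    qed
  qed
qed simp

text \<open>The square root is essential: the odds themselves would lead to the sum of
  \<open>1 / (N - a)\<close>, which grows like \<open>ln N\<close>, whereas the sum of
  \<open>1 / sqrt (a * (N - a))\<close> over \<open>a > N / 2\<close> stays bounded.\<close>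

lemma ua_mean_heavy_odds_le:
  "ua_mean n (path_sum (\<lambda>s. sqrt (heavy_odds (Suc n) s))) \<le> exp 3"
proof -
  define N where "N = real (Suc n)"
  have N: "0 < N" by (simp add: N_def)
  let ?g = "\<lambda>s. sqrt (heavy_odds (Suc n) s)"
  have term_le: "?g a / real a \<le> 2 * sqrt (2 / N) * (sqrt (N - real a) - sqrt (N - real (Suc a)))"
    if a: "a \<in> {1..n}" for a
  proof (cases "Suc n < 2 * a")
    case False
    thus ?thesis using a by (simp add: heavy_odds_def N_def)
  next
    case True
    define b where "b = N - real a"
    have b: "1 \<le> b" using a by (simp add: b_def N_def)
    have a0: "0 < real a" "N / 2 \<le> real a" using a True by (auto simp: N_def)
    have "?g a / real a = sqrt (1 / real a) * (1 / sqrt b)"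
    proof -
      have "?g a = sqrt (real a) / sqrt b"
        using a True by (simp add: heavy_odds_def b_def N_def real_sqrt_divide)
      hence "?g a / real a = sqrt (real a) / real a * (1 / sqrt b)" by simp
      also have "sqrt (real a) / real a = sqrt (1 / real a)"
        using a0 by (simp add: real_sqrt_divide real_div_sqrt field_simps)
      finally show ?thesis .
    qed
    \<comment> \<open>The first factor uses \<open>a \<ge> N / 2\<close>; the second makes the sum
      telescope.\<close>
    also have "\<dots> \<le> sqrt (2 / N) * (2 * (sqrt b - sqrt (b - 1)))"
    proof (intro mult_mono real_sqrt_le_mono)
      show "1 / real a \<le> 2 / N" using a0 N by (simp add: field_simps)
      have "(sqrt b - sqrt (b - 1)) * (sqrt b + sqrt (b - 1)) = 1"
        using b by (simp add: algebra_simps flip: power2_eq_square)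
      moreover have "(sqrt b - sqrt (b - 1)) * (sqrt b + sqrt (b - 1)) \<le> (sqrt b - sqrt (b - 1)) * (2 * sqrt b)"
        using b by (intro mult_left_mono) auto
      ultimately show "1 / sqrt b \<le> 2 * (sqrt b - sqrt (b - 1))"
        using b by (simp add: field_simps)
    qed (use N b in auto)
    finally show ?thesis by (simp add: b_def algebra_simps)
  qed
  have "ua_mean n (path_sum ?g) = (\<Prod>a\<in>{1..n}. 1 + ?g a / real a)"
    by (rule ua_mean_path_sum)
  also have "\<dots> \<le> (\<Prod>a\<in>{1..n}. exp (?g a / real a))"
    by (intro prod_mono conjI exp_ge_add_one_self) (simp add: heavy_odds_nonneg)
  also have "\<dots> = exp (\<Sum>a\<in>{1..n}. ?g a / real a)"
    by (simp add: exp_sum)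
  also have "\<dots> \<le> exp 3"
  proof -
    have "(\<Sum>a\<in>{1..n}. ?g a / real a)
        \<le> (\<Sum>a\<in>{1..n}. 2 * sqrt (2 / N) * (sqrt (N - real a) - sqrt (N - real (Suc a))))"
      by (intro sum_mono term_le)
    also have "\<dots> = 2 * sqrt (2 / N) * (\<Sum>a\<in>{1..n}. sqrt (N - real a) - sqrt (N - real (Suc a)))"
      by (simp add: sum_distrib_left)
    also have "(\<Sum>a\<in>{1..n}. sqrt (N - real a) - sqrt (N - real (Suc a))) = sqrt (N - 1)"
    proof -
      have "(\<Sum>a\<in>{1..m}. sqrt (N - real a) - sqrt (N - real (Suc a))) = sqrt (N - 1) - sqrt (N - real (Suc m))" for m
        by (induction m) auto
      thus ?thesis by (simp add: N_def)
    qed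
    also have "2 * sqrt (2 / N) * sqrt (N - 1) \<le> 2 * sqrt (2 / N) * sqrt N"
      using N by (intro mult_left_mono) auto
    also have "\<dots> = 2 * sqrt 2" using N by (simp add: real_sqrt_divide)
    also have "\<dots> \<le> 3"
    proof -
      have "sqrt 2 \<le> 3 / 2" by (intro real_le_lsqrt) (auto simp: power2_eq_square)
      thus ?thesis by simp
    qed
    finally show ?thesis by simp
  qed
  finally show ?thesis .
qed

text \<open>For a node of \<open>G\<close> the product of \<open>s / (N - s)\<close> over its path
  is at least 1, and so is its \<open>p\<close>-th root. Summing an upper bound for this root over
  all nodes therefore counts \<open>G\<close>. Squaring the first path sum undoes the square roots
  in it.\<close>

lemma card_central_le:
  assumes T: "rt_distinct T" and p: "0 < p"
  defines "N \<equiv> rt_size T"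
  defines "G \<equiv> {v \<in> set_rtree T. centrality (rt_graph T) v \<le> centrality (rt_graph T) (rt_root T)}"
  shows "real (card G) \<le> root p ((path_sum (\<lambda>s. sqrt (heavy_odds N s)) T)\<^sup>2)
           * path_sum (\<lambda>s. root p (2 * real s / real N)) T"
proof -
  define Y where "Y = path_sum (\<lambda>s. sqrt (heavy_odds N s)) T"
  define f where "f = (\<lambda>s. root p (2 * real s / real N))"
  have N: "0 < real N" by (simp add: N_def)
  have f0: "0 \<le> f s" for s using p by (simp add: f_def real_root_ge_zero)
  have "1 \<le> root p (Y\<^sup>2) * path_prod f T v" if v: "v \<in> G" for v
  proof -
    let ?r = "\<lambda>s. (real N - real s) / real s"
    let ?h = "\<lambda>s. (max 1 (sqrt (heavy_odds N s)))\<^sup>2"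
    have "real (centrality (rt_graph T) v) = path_prod ?r T v * real (centrality (rt_graph T) (rt_root T))"
      unfolding N_def using v by (intro centrality_part[OF T rt_parts_self]) (simp add: G_def)
    moreover have "0 < centrality (rt_graph T) v" "0 < centrality (rt_graph T) (rt_root T)"
      "centrality (rt_graph T) v \<le> centrality (rt_graph T) (rt_root T)"
      using v centrality_pos[OF T] by (auto simp: G_def)
    ultimately have "path_prod ?r T v = real (centrality (rt_graph T) v) / real (centrality (rt_graph T) (rt_root T))"
      "0 < centrality (rt_graph T) v" "centrality (rt_graph T) v \<le> centrality (rt_graph T) (rt_root T)"
      by (simp_all add: eq_divide_eq)
    hence "0 < path_prod ?r T v" "path_prod ?r T v \<le> 1"
      by (simp_all only:) (simp_all add: divide_le_eq)
    hence "1 \<le> inverse (path_prod ?r T v)" by (simp add: one_le_inverse)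
    also have "\<dots> = path_prod (\<lambda>s. inverse (?r s)) T v" by (rule path_prod_inverse[symmetric])
    \<comment> \<open>For heavy \<open>s\<close>, \<open>?h s\<close> is the exact factor and
      \<open>2 * s / N\<close> is at least 1; for light \<open>s\<close>, \<open>?h s\<close> is 1
      and \<open>N - s\<close> is at least \<open>N / 2\<close>.\<close>
    also have "\<dots> \<le> path_prod (\<lambda>s. ?h s * (2 * real s / real N)) T v"
    proof (rule conjunct2[OF path_prod_mono])
      fix s assume s: "1 \<le> s" "s < rt_size T"
      have sN: "real s < real N" "0 < real s" using s by (auto simp: N_def)
      show "0 \<le> inverse (?r s) \<and> inverse (?r s) \<le> ?h s * (2 * real s / real N)"
      proof (cases "N < 2 * s")
        case True
        have "1 \<le> heavy_odds N s" using True s by (intro heavy_odds_ge_1) (auto simp: N_def)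
        hence "?h s = heavy_odds N s" by simp
        also have "\<dots> = inverse (?r s)" using True s by (simp add: heavy_odds_def N_def)
        finally have h: "?h s = inverse (?r s)" .
        have "1 \<le> 2 * real s / real N" using True N by (simp add: field_simps)
        moreover have "0 \<le> inverse (?r s)" using sN by simp
        ultimately show ?thesis unfolding h using mult_left_mono[of 1 "2 * real s / real N" "inverse (?r s)"] by simp
      next
        case False
        hence "?h s = 1" by (simp add: heavy_odds_def)
        moreover have "inverse (?r s) \<le> 2 * real s / real N"
          using False sN N by (simp add: field_simps mult_left_mono)
        ultimately show ?thesis using sN by simp
      qed
    qed
    also have "\<dots> = (path_prod (\<lambda>s. max 1 (sqrt (heavy_odds N s))) T v)\<^sup>2 * path_prod (\<lambda>s. 2 * real s / real N) T v"
      by (simp only: path_prod_mult power2_eq_square)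
    also have "\<dots> \<le> Y\<^sup>2 * path_prod (\<lambda>s. 2 * real s / real N) T v"
      unfolding Y_def using path_prod_heavy_odds_le[of T N v]
      by (intro mult_right_mono power_mono path_prod_nonneg) (auto simp: N_def)
    finally have "root p 1 \<le> root p (Y\<^sup>2 * path_prod (\<lambda>s. 2 * real s / real N) T v)"
      using p by (simp only: real_root_le_iff)
    thus ?thesis using p by (simp add: real_root_mult f_def path_prod_root)
  qed
  hence "real (card G) \<le> (\<Sum>v\<in>G. root p (Y\<^sup>2) * path_prod f T v)"
    using sum_mono[of G "\<lambda>_. 1 :: real" "\<lambda>v. root p (Y\<^sup>2) * path_prod f T v"] by simp
  also have "\<dots> \<le> (\<Sum>v\<in>set_rtree T. root p (Y\<^sup>2) * path_prod f T v)"
    using p f0 by (intro sum_mono2) (auto simp: G_def real_root_ge_zero intro!: mult_nonneg_nonneg path_prod_nonneg)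
  also have "\<dots> = root p (Y\<^sup>2) * path_sum f T"
    by (simp add: path_sum_eq_sum_path_prod[OF T] sum_distrib_left)
  finally show ?thesis by (simp add: Y_def f_def)
qed

text \<open>If \<open>r\<close> is missed, the \<open>k\<close> output nodes all precede it in the
  order, and together with \<open>r\<close> they make \<open>k + 1\<close> nodes.\<close>

lemma central_output_card:
  assumes out: "central_output k T S" and fin: "finite (pverts T)" and r: "r \<in> pverts T" "r \<notin> S"
  shows "k < card {v \<in> pverts T. centrality T v \<le> centrality T r}"
proof -
  obtain vs where vs: "distinct vs" "set vs = pverts T"
    "sorted_wrt (\<lambda>u v. centrality T u \<le> centrality T v) vs" "S = set (take k vs)"
    using out by (auto simp: central_output_def)
  have split: "vs = take k vs @ drop k vs" by simp
  have rd: "r \<in> set (drop k vs)" using r vs split by (metis Un_iff set_append)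
  hence "k < length vs" by (metis drop_all empty_iff empty_set not_le)
  have "\<forall>u\<in>set (take k vs). \<forall>v\<in>set (drop k vs). centrality T u \<le> centrality T v"
    using vs(3) split by (metis sorted_wrt_append)
  hence "insert r S \<subseteq> {v \<in> pverts T. centrality T v \<le> centrality T r}"
    using rd r vs by (auto dest: in_set_takeD)
  moreover have "card (insert r S) = Suc k"
    using r vs \<open>k < length vs\<close> by (simp add: distinct_card distinct_take)
  ultimately show ?thesis
    using card_mono[of "{v \<in> pverts T. centrality T v \<le> centrality T r}" "insert r S"] fin by simp
qed

theorem theorem1p1:
  "\<exists>C c :: real. C > 0 \<and> c > 0 \<and>
     (\<forall>\<epsilon> > 0. let K = C * exp (c * sqrt (ln (1 / \<epsilon>))) in
        (\<forall>A. root_finding_algorithm (nat \<lceil>K\<rceil>) A \<longrightarrow>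
          (\<forall>n \<ge> 1. measure_pmf.prob (uniform_attachment n) {T. ua_root \<notin> A T} \<le> \<epsilon>)))"
proof -
  have "measure_pmf.prob (uniform_attachment N) {T. ua_root \<notin> A T} \<le> \<epsilon>"
    if \<epsilon>: "0 < \<epsilon>" and A: "root_finding_algorithm (nat \<lceil>exp 298 * exp (292 * sqrt (ln (1 / \<epsilon>)))\<rceil>) A"
      and N: "1 \<le> N" for \<epsilon> :: real and A and N
  proof (cases "1 \<le> \<epsilon>")
    case True
    thus ?thesis using measure_pmf.prob_le_1[of "uniform_attachment N"] by (meson order_trans)
  next
    case False
    obtain n where n: "N = Suc n" using N by (cases N) auto
    define L where "L = ln (1 / \<epsilon>)"
    have L: "0 < L" and \<epsilon>L: "exp L = 1 / \<epsilon>" using \<epsilon> False by (auto simp: L_def)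
    \<comment> \<open>This choice balances \<open>2 * L / p\<close>, which comes from the root of
      \<open>y\<^sup>2\<close>, against \<open>290 * p\<close>, which comes from
      \<open>f\<close>.\<close>
    define p where "p = nat \<lceil>sqrt L\<rceil>"
    have pL: "sqrt L \<le> real p" "real p \<le> sqrt L + 1" "1 \<le> p"
      using L by (auto simp: p_def Suc_le_eq)
    have p0: "0 < p" and p1: "1 \<le> real p" using pL by auto
    have L_le: "L \<le> (real p)\<^sup>2"
      using pL(1) L by (metis real_sqrt_le_iff real_sqrt_abs abs_of_nat)
    define Y :: "unit rtree \<Rightarrow> real" where "Y = path_sum (\<lambda>s. sqrt (heavy_odds N s))"
    define F :: "unit rtree \<Rightarrow> real" where "F = path_sum (\<lambda>s. root p (2 * real s / real N))"
    \<comment> \<open>The thresholds for \<open>Y\<close> and \<open>F\<close>, each exceeded with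
      probability at most \<open>\<epsilon> / 2\<close>. In \<open>f\<close>, 290 is 288 + 2: the
      \<open>p\<close>-th moment of \<open>F\<close> is at most
      \<open>exp (288 * p\<^sup>2)\<close>, where 288 is 72 * 2 * 2, and the excess leaves
      \<open>exp (- 2 * p\<^sup>2)\<close>.\<close>
    define y where "y = 2 * exp 3 / \<epsilon>"
    define f where "f = exp (290 * real p)"
    define k where "k = nat \<lceil>exp 298 * exp (292 * sqrt L)\<rceil>"
    have y0: "0 < y" using \<epsilon> by (simp add: y_def)
    have f0: "0 < f" by (simp add: f_def)
    have Y0: "0 \<le> Y s" for s unfolding Y_def by (intro path_sum_nonneg) (simp add: heavy_odds_nonneg)
    have F0: "0 \<le> F s" for s unfolding F_def using p0 by (intro path_sum_nonneg) (simp add: real_root_ge_zero)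
    \<comment> \<open>The constants are 298 = 8 + 290 and 292 = 2 + 290. The 8 is twice the exponent
      in \<open>y \<le> exp (4 + L)\<close>, and each 290 comes from
      \<open>p \<le> sqrt L + 1\<close>.\<close>
    have yf: "root p (y\<^sup>2) * f \<le> exp 298 * exp (292 * sqrt L)"
    proof -
      have "(2::real) \<le> exp 1" using exp_ge_add_one_self[of 1] by simp
      hence "y \<le> exp 1 * exp 3 * exp L"
        unfolding y_def \<epsilon>L using \<epsilon> by (simp add: field_simps)
      hence "y\<^sup>2 \<le> (exp 1 * exp 3 * exp L)\<^sup>2" using y0 by (intro power_mono) auto
      also have "\<dots> = exp ((8 + 2 * L) / real p * real p)"
        using p0 by (simp flip: exp_add exp_double)
      also have "\<dots> = exp ((8 + 2 * L) / real p) ^ p"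
        using exp_of_nat_mult[of p "(8 + 2 * L) / real p"] by (simp only: mult.commute)
      finally have "root p (y\<^sup>2) \<le> root p (exp ((8 + 2 * L) / real p) ^ p)"
        using p0 by simp
      also have "\<dots> = exp ((8 + 2 * L) / real p)"
        using p0 by (intro real_root_power_cancel) auto
      also have "\<dots> \<le> exp (8 + 2 * sqrt L)"
      proof -
        have "L = sqrt L * sqrt L" using L by simp
        also have "\<dots> \<le> sqrt L * real p" using pL L by (intro mult_left_mono) auto
        finally have "8 + 2 * L \<le> (8 + 2 * sqrt L) * real p"
          using p1 by (simp add: algebra_simps)
        thus ?thesis using p0 by (simp add: divide_le_eq)
      qed
      finally have "root p (y\<^sup>2) * f \<le> exp (8 + 2 * sqrt L) * exp (290 * (sqrt L + 1))"
        unfolding f_def using pL by (intro mult_mono) auto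
      thus ?thesis by (simp add: mult_exp_exp algebra_simps)
    qed
    have "measure_pmf.prob (uniform_attachment N) {T. ua_root \<notin> A T}
        = measure_pmf.prob (ua_rtree n) {t. ua_root \<notin> A (rt_graph t)}"
      unfolding n uniform_attachment_eq_map_ua_rtree by (simp add: vimage_def)
    \<comment> \<open>Markov's inequality with the first moment of \<open>Y\<close> and the
      \<open>p\<close>-th moment of \<open>F\<close>, combined with the union bound.\<close>
    also have "\<dots> \<le> ua_mean n (\<lambda>s. Y s / y + (F s / f) ^ p)"
    proof (rule prob_ua_rtree_le)
      show "0 \<le> Y s / y + (F s / f) ^ p" for s using Y0 F0 y0 f0 by simp
    next
      fix t assume t: "t \<in> set_pmf (ua_rtree n)" "t \<in> {t. ua_root \<notin> A (rt_graph t)}"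
      note supp = set_pmf_ua_rtree[OF t(1)]
      have size: "rt_size t = N" using card_set_rtree[OF supp(1)] supp(2) n by simp
      have "central_output k (rt_graph t) (A (rt_graph t))"
        using A finite_tree_rt_graph[OF supp(1)] by (simp add: root_finding_algorithm_def k_def L_def)
      hence "k < card {v \<in> set_rtree t. centrality (rt_graph t) v \<le> centrality (rt_graph t) (rt_root t)}"
        using central_output_card[of k "rt_graph t" _ "rt_root t"] t(2) supp(3) rt_root_in[of t]
        by (simp add: ua_root_def)
      hence "real k < root p ((Y (rt_shape t))\<^sup>2) * F (rt_shape t)"
        using card_central_le[OF supp(1) p0] unfolding size Y_def F_def by simp
      moreover have "exp 298 * exp (292 * sqrt L) \<le> real k" unfolding k_def by linarith
      ultimately have big: "root p (y\<^sup>2) * f < root p ((Y (rt_shape t))\<^sup>2) * F (rt_shape t)"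
        using yf by linarith
      have "y \<le> Y (rt_shape t) \<or> f \<le> F (rt_shape t)"
      proof (rule ccontr)
        assume "\<not> ?thesis"
        hence "root p ((Y (rt_shape t))\<^sup>2) * F (rt_shape t) \<le> root p (y\<^sup>2) * f"
          using Y0 F0 p0 y0 by (intro mult_mono) (auto simp: real_root_ge_zero power_mono)
        thus False using big by simp
      qed
      thus "1 \<le> Y (rt_shape t) / y + (F (rt_shape t) / f) ^ p"
      proof
        assume "y \<le> Y (rt_shape t)"
        hence "1 \<le> Y (rt_shape t) / y" using y0 by simp
        moreover have "0 \<le> (F (rt_shape t) / f) ^ p" using F0 f0 by simp
        ultimately show ?thesis by linarith
      next
        assume "f \<le> F (rt_shape t)"
        hence "1 \<le> (F (rt_shape t) / f) ^ p" using f0 by (intro one_le_power) simp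
        moreover have "0 \<le> Y (rt_shape t) / y" using Y0 y0 by simp
        ultimately show ?thesis by linarith
      qed
    qed
    also have "\<dots> = ua_mean n Y / y + ua_mean n (\<lambda>s. F s ^ p) / f ^ p"
      using ua_mean_cmult[of n "1 / y" Y] ua_mean_cmult[of n "1 / f ^ p" "\<lambda>s. F s ^ p"]
      by (simp add: ua_mean_add power_divide)
    also have "\<dots> \<le> \<epsilon> / 2 + \<epsilon> / 2"
    proof (rule add_mono)
      have "ua_mean n Y / y \<le> exp 3 / y"
        using ua_mean_heavy_odds_le[of n] y0 unfolding Y_def n by (intro divide_right_mono) auto
      thus "ua_mean n Y / y \<le> \<epsilon> / 2" by (simp add: y_def)
    next
      have two: "2 * real (Suc n) / real (Suc n) = 2" by (simp del: of_nat_Suc)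
      have "ua_mean n (\<lambda>s. F s ^ p) \<le> exp (72 * (real p * real (p + p) * root p 2))"
        using ua_mean_path_sum_power[OF pL(3), of n N p] two unfolding F_def by (simp only: n lessI order_refl)
      also have "\<dots> \<le> exp (288 * (real p)\<^sup>2)"
      proof -
        have "root p 2 \<le> root p (2 ^ p)"
          using p0 power_increasing[of 1 p "2::real"] by simp
        also have "\<dots> = 2" using p0 by (intro real_root_power_cancel) auto
        finally have "real p * real (p + p) * root p 2 \<le> real p * real (p + p) * 2"
          by (intro mult_left_mono) auto
        thus ?thesis by (simp add: power2_eq_square algebra_simps)
      qed
      finally have "ua_mean n (\<lambda>s. F s ^ p) / f ^ p \<le> exp (288 * (real p)\<^sup>2) / f ^ p"
        using f0 by (intro divide_right_mono) auto
      also have "\<dots> = exp (- (2 * (real p)\<^sup>2))"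
        unfolding f_def exp_of_nat_mult[symmetric] by (simp add: power2_eq_square flip: exp_diff)
      also have "\<dots> \<le> exp (- L - 1)"
      proof -
        have "1 \<le> (real p)\<^sup>2" using p1 by (simp add: one_le_power)
        thus ?thesis using L_le by simp
      qed
      also have "\<dots> \<le> \<epsilon> / 2"
      proof -
        have "(2::real) \<le> exp 1" using exp_ge_add_one_self[of 1] by simp
        hence "\<epsilon> / exp 1 \<le> \<epsilon> / 2" using \<epsilon> by (intro frac_le) auto
        moreover have "exp (- L - 1) = \<epsilon> / exp 1"
          using \<epsilon>L \<epsilon> by (simp add: exp_diff exp_minus)
        ultimately show ?thesis by simp
      qed
      finally show "ua_mean n (\<lambda>s. F s ^ p) / f ^ p \<le> \<epsilon> / 2" .
    qed
    finally show ?thesis by simp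
  qed
  thus ?thesis
    unfolding Let_def by (intro exI[of _ "exp 298"] exI[of _ 292]) auto
qed

end
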